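(* Let $\mathcal{A}'$ be a free arrangement in $V=\mathbb{K}^\ell$ with $\exp(\mathcal{A}')=(1,d_2,\ldots,d_\ell)$, where $1\le d_2\le\cdots\le d_\ell$. Let $2\le q\le\ell$ and let $H_q,\ldots,H_\ell$ be linear hyperplanes in $V$. Put $\mathcal{A}_j'':=(\mathcal{A}'\cup\{H_j\})^{H_j}$ for $j=q,\ldots,\ell$ and $\mathcal{A}:=\mathcal{A}'\cup\{H_q,\ldots,H_\ell\}$. Assume: (1) $|\mathcal{A}'|-|\mathcal{A}_j''|=d_j$ for $j=q,\ldots,\ell$; (2) $X:=\bigcap_{i=q}^\ell H_i$ has codimension $\ell-q+1$ in $V$; (3) $X\not\subset\bigcup_{K\in\mathcal{A}'}K$. Then $\mathcal{A}$ is free with exponents $(1,d_2,\ldots,d_{q-1},d_q+1,\ldots,d_\ell+1)$. Moreover, there is a homogeneous basis $\theta_E,\theta_2,\ldots,\theta_{q-1},\eta_q,\ldots,\eta_\ell$ for $D(\mathcal{A}')$ such that $\deg\theta_i=d_i$, $\deg\eta_j=d_j$, $\theta_i\in D(\mathcal{A})$ and $\eta_j\in D(\mathcal{A}\setminus\{H_j\})$ for all $i\in\{2,\ldots,q-1\}$ and $j\in\{q,\ldots,\ell\}$.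
   Context: $\mathbb{K}$ is an arbitrary field, $V=\mathbb{K}^\ell$, $S=\mathbb{K}[x_1,\ldots,x_\ell]$ its coordinate ring, $\operatorname{Der}S=\bigoplus_{i=1}^\ell S\,\partial_{x_i}$, and $\theta_E=\sum_{i=1}^\ell x_i\partial_{x_i}$ is the Euler derivation. A (hyperplane) arrangement $\mathcal{A}$ in $V$ is a finite set of linear hyperplanes of $V$; for each hyperplane $H$ fix a linear form $\alpha_H\in V^*$ with $\ker\alpha_H=H$. A derivation $\theta\in\operatorname{Der}S$ is homogeneous of degree $d$ if $\theta(\alpha)$ is a homogeneous polynomial of degree $d$ for all $\alpha\in V^*$ with $\theta(\alpha)\ne0$. The logarithmic derivation module is $D(\mathcal{A})=\{\theta\in\operatorname{Der}S\mid \theta(\alpha_H)\in S\alpha_H\ \text{for all }H\in\mathcal{A}\}$. $\mathcal{A}$ is free with exponents $\exp(\mathcal{A})=(d_1,\ldots,d_\ell)$ (a multiset) if $D(\mathcal{A})$ is a free $S$-module with a homogeneous basis $\theta_1,\ldots,\theta_\ell$, $\deg\theta_i=d_i$. For $H\in\mathcal{A}$, $\mathcal{A}^H=\{H\cap L\mid L\in\mathcal{A}\setminus\{H\}\}$, an arrangement in $H$. *)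

theory Defs
  imports "HOL-Analysis.Analysis" "HOL-Library.Poly_Mapping" "HOL-Library.Multiset"
begin

text \<open>
  The space \<open>V = K\<^sup>\<ell>\<close> is \<^typ>\<open>'k ^ 'n\<close> with \<open>\<ell> = CARD('n)\<close>, and its coordinate ring \<open>S\<close> has one
  variable for each element of \<^typ>\<open>'n\<close>. A polynomial maps finitely many monomials, given as
  exponent vectors, to their coefficients; its product is the one of \<^theory>\<open>HOL-Library.Poly_Mapping\<close>.
\<close>

type_synonym ('n, 'k) mpoly = "('n \<Rightarrow>\<^sub>0 nat) \<Rightarrow>\<^sub>0 'k"

definition mvar :: "'n \<Rightarrow> ('n, 'k::comm_ring_1) mpoly" where
  "mvar i = Poly_Mapping.single (Poly_Mapping.single i 1) 1"

definition mconst :: "'k::comm_ring_1 \<Rightarrow> ('n, 'k) mpoly" where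
  "mconst c = Poly_Mapping.single 0 c"

definition mhomogeneous :: "nat \<Rightarrow> ('n::finite, 'k::comm_ring_1) mpoly \<Rightarrow> bool" where
  "mhomogeneous d p \<longleftrightarrow>
     (\<forall>m \<in> Poly_Mapping.keys p. (\<Sum>i\<in>UNIV. Poly_Mapping.lookup m i) = d)"

text \<open>
  Partial derivative. If the variable \<open>i\<close> does not occur in the monomial \<open>m\<close>, the truncated
  subtraction of exponents is harmless because the coefficient is \<open>0\<close>.
\<close>

definition mpdiff :: "'n \<Rightarrow> ('n, 'k::comm_ring_1) mpoly \<Rightarrow> ('n, 'k) mpoly" where
  "mpdiff i p = (\<Sum>m\<in>Poly_Mapping.keys p.
     Poly_Mapping.single (m - Poly_Mapping.single i 1)
       (of_nat (Poly_Mapping.lookup m i) * Poly_Mapping.lookup p m))"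

text \<open>
  A vector \<open>a\<close> encodes an element of the dual space of \<open>V\<close>, namely \<open>v \<mapsto> \<Sum>i. a\<^sub>i v\<^sub>i\<close>;
  \<open>lin_form a\<close> is the same functional viewed as an element of \<open>S\<close>.
\<close>

definition lin_eval :: "'k::field ^ 'n \<Rightarrow> 'k ^ 'n \<Rightarrow> 'k" where
  "lin_eval a v = (\<Sum>i\<in>UNIV. a $ i * v $ i)"

definition lin_form :: "'k::field ^ 'n \<Rightarrow> ('n, 'k) mpoly" where
  "lin_form a = (\<Sum>i\<in>UNIV. mconst (a $ i) * mvar i)"

text \<open>
  \<open>Der S\<close> is the free \<open>S\<close>-module on the partial derivatives, so a derivation is given by its
  coefficient vector.
\<close>

type_synonym ('n, 'k) derivation = "(('n, 'k) mpoly) ^ 'n"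

definition der_apply ::
  "('n::finite, 'k::field) derivation \<Rightarrow> ('n, 'k) mpoly \<Rightarrow> ('n, 'k) mpoly" where
  "der_apply \<theta> f = (\<Sum>i\<in>UNIV. \<theta> $ i * mpdiff i f)"

definition euler_der :: "('n::finite, 'k::field) derivation" where
  "euler_der = (\<chi> i. mvar i)"

interpretation der: module
  "(*s) :: ('n::finite, 'k::field) mpoly \<Rightarrow> ('n, 'k) derivation \<Rightarrow> ('n, 'k) derivation"
  by unfold_locales (simp_all add: vec_eq_iff algebra_simps)

definition der_homogeneous :: "nat \<Rightarrow> ('n::finite, 'k::field) derivation \<Rightarrow> bool" where
  "der_homogeneous d \<theta> \<longleftrightarrow>
     (\<forall>a. der_apply \<theta> (lin_form a) \<noteq> 0 \<longrightarrow> mhomogeneous d (der_apply \<theta> (lin_form a)))"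

definition hyperplane :: "('k::field ^ 'n) set \<Rightarrow> bool" where
  "hyperplane H \<longleftrightarrow> vec.subspace H \<and> vec.dim H + 1 = CARD('n)"

definition arrangement :: "('k::field ^ 'n) set set \<Rightarrow> bool" where
  "arrangement \<A> \<longleftrightarrow> finite \<A> \<and> (\<forall>H\<in>\<A>. hyperplane H)"

text \<open>The choice of \<open>\<alpha>\<^sub>H\<close>; see \<open>lin_eval_defining_vec\<close> below for its existence.\<close>

definition defining_vec :: "('k::field ^ 'n) set \<Rightarrow> 'k ^ 'n" where
  "defining_vec H = (SOME a. {v. lin_eval a v = 0} = H)"

definition defining_form :: "('k::field ^ 'n) set \<Rightarrow> ('n, 'k) mpoly" where
  "defining_form H = lin_form (defining_vec H)"

definition log_der :: "('k::field ^ 'n) set set \<Rightarrow> ('n, 'k) derivation set" where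
  "log_der \<A> = {\<theta>. \<forall>H\<in>\<A>. defining_form H dvd der_apply \<theta> (defining_form H)}"

text \<open>The family \<open>\<theta> 1, \<dots>, \<theta> \<ell>\<close> is a homogeneous basis of \<open>D(\<A>)\<close> with \<open>deg (\<theta> i) = d i\<close>.\<close>

definition homogeneous_basis ::
  "('k::field ^ 'n) set set \<Rightarrow> (nat \<Rightarrow> nat) \<Rightarrow> (nat \<Rightarrow> ('n, 'k) derivation) \<Rightarrow> bool" where
  "homogeneous_basis \<A> d \<theta> \<longleftrightarrow>
     inj_on \<theta> {1..CARD('n)} \<and>
     der.independent (\<theta> ` {1..CARD('n)}) \<and>
     der.span (\<theta> ` {1..CARD('n)}) = log_der \<A> \<and>
     (\<forall>i\<in>{1..CARD('n)}. der_homogeneous (d i) (\<theta> i))"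

definition free_with_exponents :: "('k::field ^ 'n) set set \<Rightarrow> nat multiset \<Rightarrow> bool" where
  "free_with_exponents \<A> E \<longleftrightarrow>
     (\<exists>d \<theta>. homogeneous_basis \<A> d \<theta> \<and> E = image_mset d (mset_set {1..CARD('n)}))"

definition restriction ::
  "('k::field ^ 'n) set set \<Rightarrow> ('k ^ 'n) set \<Rightarrow> ('k ^ 'n) set set" where
  "restriction \<A> H = {H \<inter> L | L. L \<in> \<A> - {H}}"

text \<open>The following facts confirm that the definitions above mean what they should.\<close>

lemma lin_eval_defining_vec:
  fixes H :: "('k::field ^ 'n) set"
  assumes "hyperplane H"
  shows "{v. lin_eval (defining_vec H) v = 0} = H"
proof -
  have sub: "vec.subspace H" and dim: "vec.dim H + 1 = CARD('n)"
    using assms by (auto simp: hyperplane_def)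
  obtain B where B: "B \<subseteq> H" "vec.independent B" "H \<subseteq> vec.span B" "card B = vec.dim H"
    using vec.basis_exists by blast
  have spanB: "vec.span B = H"
    using B sub by (metis subset_antisym vec.span_minimal)
  have "H \<noteq> UNIV"
  proof
    assume "H = UNIV"
    then have "vec.dim H = CARD('n)"
      by (simp add: card_cart_basis)
    with dim show False by simp
  qed
  then obtain w where w: "w \<notin> H" by blast
  have indep: "vec.independent (insert w B)"
    using B(2) w spanB by (simp add: vec.independent_insertI)
  have finB: "finite B"
    using B(2) by (rule vec.finiteI_independent)
  have "w \<notin> B" using w B(1) by blast
  then have card: "card (insert w B) = CARD('n)"
    using finB B(4) dim by simp
  have spanw: "v \<in> vec.span (insert w B)" for v
  proof -
    have "UNIV \<subseteq> vec.span (insert w B)"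
      using vec.card_eq_dim[of "insert w B" UNIV] indep card finB by (simp add: card_cart_basis)
    then show ?thesis by auto
  qed
  define i0 :: 'n where "i0 = undefined"
  obtain f where f: "Vector_Spaces.linear (*s) (*s) f"
    and fB: "\<forall>x\<in>insert w B. f x = (if x = w then axis i0 1 else (0::'k^'n))"
    using vec.linear_independent_extend[OF indep,
        where f = "\<lambda>x. if x = w then axis i0 1 else (0::'k^'n)"] by blast
  have add: "f (x + y) = f x + f y" and scale: "f (c *s x) = c *s f x" for x y c
    using f by (simp_all add: Vector_Spaces.linear_iff)
  have zero: "f 0 = 0" using scale[of 0 0] by simp
  have mat: "f v = matrix f *v v" for v
    using f by (simp add: matrix_works)
  define a where "a = row i0 (matrix f)"
  have ev: "lin_eval a v = f v $ i0" for v
    by (subst mat[of v]) (simp add: lin_eval_def a_def row_def matrix_vector_mult_def)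
  have f0: "f h = 0" if "h \<in> H" for h
  proof -
    have "f x = 0" if "x \<in> B" for x
      using fB that \<open>w \<notin> B\<close> by auto
    moreover have "vec.subspace {x. f x = 0}"
      by (simp add: vec.subspace_def add scale zero)
    ultimately have "vec.span B \<subseteq> {x. f x = 0}"
      by (intro vec.span_minimal) auto
    then show ?thesis using that spanB by auto
  qed
  have "lin_eval a v = 0 \<longleftrightarrow> v \<in> H" for v
  proof
    assume z: "lin_eval a v = 0"
    obtain c where c: "v - c *s w \<in> H"
      using spanw[of v] spanB by (auto simp: vec.span_insert)
    have "f v = f (v - c *s w) + c *s f w"
      using add[of "v - c *s w" "c *s w"] by (simp add: scale)
    then have "f v = c *s axis i0 1"
      using f0[OF c] fB by simp
    with z have "c = 0" by (simp add: ev axis_def)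
    with c show "v \<in> H" by simp
  next
    assume "v \<in> H"
    then show "lin_eval a v = 0" by (simp add: ev f0)
  qed
  then have "{v. lin_eval a v = 0} = H" by auto
  then show ?thesis
    unfolding defining_vec_def by (rule someI)
qed

lemma lin_form_conv_single:
  "lin_form a = (\<Sum>i\<in>UNIV. Poly_Mapping.single (Poly_Mapping.single i 1) (a $ i))"
  by (simp add: lin_form_def mconst_def mvar_def mult_single)

lemma mpdiff_superset:
  assumes "finite M" "Poly_Mapping.keys p \<subseteq> M"
  shows "mpdiff i p = (\<Sum>m\<in>M. Poly_Mapping.single (m - Poly_Mapping.single i 1)
       (of_nat (Poly_Mapping.lookup m i) * Poly_Mapping.lookup p m))"
  unfolding mpdiff_def using assms
  by (intro sum.mono_neutral_left) (auto simp: in_keys_iff)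

lemma mpdiff_add: "mpdiff i (p + q) = mpdiff i p + mpdiff i q"
proof -
  let ?M = "Poly_Mapping.keys p \<union> Poly_Mapping.keys q"
  have "Poly_Mapping.keys (p + q) \<subseteq> ?M" by (rule keys_add)
  then show ?thesis
    by (simp add: mpdiff_superset[of ?M] lookup_add distrib_left single_add sum.distrib)
qed

lemma mpdiff_single:
  "mpdiff i (Poly_Mapping.single m c) =
     Poly_Mapping.single (m - Poly_Mapping.single i 1) (of_nat (Poly_Mapping.lookup m i) * c)"
  by (cases "c = 0") (simp_all add: mpdiff_def)

lemma mpdiff_sum: "finite I \<Longrightarrow> mpdiff i (sum f I) = (\<Sum>j\<in>I. mpdiff i (f j))"
  by (induction I rule: finite_induct) (simp_all add: mpdiff_add, simp add: mpdiff_def)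

lemma mpdiff_lin_form: "mpdiff i (lin_form a) = mconst (a $ i)"
proof -
  have "mpdiff i (lin_form a) = (\<Sum>j\<in>UNIV. if j = i then mconst (a $ i) else 0)"
    unfolding lin_form_conv_single mpdiff_sum[OF finite]
    by (intro sum.cong) (auto simp: mpdiff_single mconst_def lookup_single when_def)
  then show ?thesis by simp
qed

lemma der_apply_lin_form: "der_apply \<theta> (lin_form a) = (\<Sum>i\<in>UNIV. mconst (a $ i) * \<theta> $ i)"
  by (simp add: der_apply_def mpdiff_lin_form mult.commute)

lemma euler_der_lin_form: "der_apply euler_der (lin_form a) = lin_form a"
  unfolding der_apply_lin_form by (simp add: euler_der_def lin_form_def)

end

theory Submission
  imports Defs "HOL-Combinatorics.Permutations"
begin

text \<open>
  Let \<open>H\<close> be a hyperplane outside \<open>\<A>'\<close> with form \<open>\<alpha>\<close> and \<open>e = |\<A>'| - |(\<A>' \<union> {H})\<^sup>H|\<close>. By Terao, there is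
  a form \<open>B\<close> of degree \<open>e\<close> such that \<open>\<theta>(\<alpha>) \<in> (\<alpha>, B)\<close> for all \<open>\<theta> \<in> D(\<A>')\<close>. So a homogeneous \<open>\<theta>\<close> of degree
  \<open>< e\<close> maps \<open>\<alpha>\<close> into \<open>(\<alpha>)\<close>, and if some \<open>\<theta>\<close> of degree \<open>e\<close> does not, then \<open>\<theta>(\<alpha>)\<close> generates all values
  \<open>\<eta>(\<alpha>)\<close> modulo \<open>\<alpha>\<close> and can be used to clear them.

  Choose a point \<open>p \<in> X\<close> outside \<open>\<A>'\<close>. The values at \<open>p\<close> of a basis of \<open>D(\<A>')\<close> form a basis of \<open>V\<close>, on
  which the independent forms \<open>\<alpha>\<^sub>q, \<dots>, \<alpha>\<^sub>\<ell>\<close> can be diagonalised by Gaussian elimination, from \<open>\<ell>\<close> down to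
  \<open>q\<close>. By the degree condition and the order of the exponents, every pivot for \<open>\<alpha>\<^sub>j\<close> has degree \<open>d\<^sub>j\<close>, so
  each step lifts to the module. In the resulting basis, \<open>\<theta>\<^sub>k(\<alpha>\<^sub>j) \<in> (\<alpha>\<^sub>j)\<close> exactly for \<open>k \<noteq> j\<close>, and
  multiplying \<open>\<theta>\<^sub>j\<close> by \<open>\<alpha>\<^sub>j\<close> for \<open>j \<ge> q\<close> yields a basis of \<open>D(\<A>)\<close>.
\<close>

section \<open>Polynomial rings\<close>

abbreviation keys where "keys \<equiv> Poly_Mapping.keys"
abbreviation lookup where "lookup \<equiv> Poly_Mapping.lookup"
abbreviation single where "single \<equiv> Poly_Mapping.single"

text \<open>The coefficient is an argument of \<open>h\<close> rather than a factor, so one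
  construction covers change of monomials, evaluation, substitution and homogeneous
  components.\<close>

definition pm_ext :: "('m \<Rightarrow> 'k::comm_ring_1 \<Rightarrow> 'r::comm_ring_1) \<Rightarrow> ('m \<Rightarrow>\<^sub>0 'k) \<Rightarrow> 'r" where
  "pm_ext h f = (\<Sum>m\<in>keys f. h m (lookup f m))"

lemma pm_ext_superset:
  assumes "finite M" "keys f \<subseteq> M" "\<And>m. h m 0 = 0"
  shows "pm_ext h f = (\<Sum>m\<in>M. h m (lookup f m))"
  unfolding pm_ext_def using assms
  by (intro sum.mono_neutral_left) (auto simp: in_keys_iff)

lemma sum_single_lookup: "(\<Sum>m\<in>keys f. single m (lookup f m)) = f"
proof (rule poly_mapping_eqI)
  fix k
  show "lookup (\<Sum>m\<in>keys f. single m (lookup f m)) k = lookup f k"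
    by (auto simp: lookup_sum lookup_single when_def in_keys_iff)
qed

locale pm_additive =
  fixes h :: "'m \<Rightarrow> 'k::comm_ring_1 \<Rightarrow> 'r::comm_ring_1"
  assumes h_add: "h m (a + b) = h m a + h m b"
begin

lemma h_zero: "h m 0 = 0"
  using h_add[of m 0 0] by simp

lemma ext_zero: "pm_ext h 0 = 0"
  by (simp add: pm_ext_def)

lemma ext_add: "pm_ext h (f + g) = pm_ext h f + pm_ext h g"
proof -
  let ?M = "keys f \<union> keys g"
  have "keys (f + g) \<subseteq> ?M" by (rule keys_add)
  then show ?thesis
    by (simp add: pm_ext_superset[of ?M] h_zero lookup_add h_add sum.distrib)
qed

lemma ext_sum: "pm_ext h (sum f I) = (\<Sum>i\<in>I. pm_ext h (f i))"
  by (induction I rule: infinite_finite_induct) (simp_all add: ext_zero ext_add)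

lemma ext_uminus: "pm_ext h (- f) = - pm_ext h f"
  using ext_add[of f "- f"] by (simp add: ext_zero add_eq_0_iff)

lemma ext_diff: "pm_ext h (f - g) = pm_ext h f - pm_ext h g"
  using ext_add[of f "- g"] by (simp add: ext_uminus)

lemma ext_single: "pm_ext h (single m c) = h m c"
  by (cases "c = 0") (simp_all add: pm_ext_def h_zero)

end

locale pm_hom = pm_additive h for h :: "'m::comm_monoid_add \<Rightarrow> 'k::comm_ring_1 \<Rightarrow> 'r::comm_ring_1" +
  assumes h_one: "h 0 1 = 1"
    and h_mult: "h (m + m') (a * b) = h m a * h m' b"
begin

lemma ext_one: "pm_ext h 1 = 1"
  using ext_single[of 0 1] by (simp add: h_one)

lemma ext_mult: "pm_ext h (f * g) = pm_ext h f * pm_ext h g"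
proof -
  have "f * g = (\<Sum>m\<in>keys f. single m (lookup f m)) * (\<Sum>m'\<in>keys g. single m' (lookup g m'))"
    by (simp add: sum_single_lookup)
  also have "\<dots> = (\<Sum>m\<in>keys f. \<Sum>m'\<in>keys g. single (m + m') (lookup f m * lookup g m'))"
    by (simp add: sum_product mult_single)
  finally have "pm_ext h (f * g) = (\<Sum>m\<in>keys f. \<Sum>m'\<in>keys g. h m (lookup f m) * h m' (lookup g m'))"
    by (simp add: ext_sum ext_single h_mult)
  then show ?thesis
    by (simp add: pm_ext_def sum_product)
qed

lemma ext_power: "pm_ext h (f ^ n) = pm_ext h f ^ n"
  by (induction n) (simp_all add: ext_one ext_mult)

lemma ext_prod: "pm_ext h (prod f I) = (\<Prod>i\<in>I. pm_ext h (f i))"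
  by (induction I rule: infinite_finite_induct) (simp_all add: ext_one ext_mult)

lemma ext_dvd: "f dvd g \<Longrightarrow> pm_ext h f dvd pm_ext h g"
  by (auto simp: ext_mult elim!: dvdE)

end

text \<open>The library knows that polynomials form an integral domain only for linearly ordered
  monomials, hence the detour through variables indexed by natural numbers.\<close>

lemma mpoly_no_zero_divisors:
  fixes f g :: "('n::finite, 'k::idom) mpoly"
  assumes "f * g = 0"
  shows "f = 0 \<or> g = 0"
proof -
  define e :: "('n \<Rightarrow>\<^sub>0 nat) \<Rightarrow> (nat \<Rightarrow>\<^sub>0 nat)"
    where "e = (\<lambda>m. \<Sum>i\<in>UNIV. single (to_nat i) (lookup m i))"
  have e_add: "e (m + m') = e m + e m'" for m m'
    by (simp add: e_def lookup_add single_add sum.distrib)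
  have e_lookup: "lookup (e m) (to_nat i) = lookup m i" for m i
    by (simp add: e_def lookup_sum lookup_single when_def inj_eq[OF inj_to_nat])
  have e_inj: "e m = e m' \<Longrightarrow> m = m'" for m m'
    by (rule poly_mapping_eqI) (metis e_lookup)
  define h :: "('n \<Rightarrow>\<^sub>0 nat) \<Rightarrow> 'k \<Rightarrow> ((nat \<Rightarrow>\<^sub>0 nat) \<Rightarrow>\<^sub>0 'k)" where "h = (\<lambda>m c. single (e m) c)"
  have "e 0 = 0"
    by (simp add: e_def)
  then interpret pm_hom h
    by unfold_locales (simp_all add: h_def e_add single_add mult_single)
  have inj: "f = 0" if "pm_ext h f = 0" for f
  proof (rule poly_mapping_eqI)
    fix k
    \<comment> \<open>Injectivity of \<open>e\<close> keeps monomials from colliding, so the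
      coefficient of \<open>f\<close> at \<open>k\<close> reappears at \<open>e k\<close>.\<close>
    have "lookup (pm_ext h f) (e k) = (\<Sum>m\<in>keys f. if m = k then lookup f m else 0)"
      unfolding pm_ext_def h_def lookup_sum
      by (intro sum.cong) (auto simp: lookup_single when_def dest: e_inj)
    then show "lookup f k = lookup 0 k"
      using that by (simp add: in_keys_iff split: if_splits)
  qed
  have "pm_ext h f * pm_ext h g = 0"
    using assms ext_mult[of f g] by (simp add: ext_zero)
  then show ?thesis
    using inj by auto
qed

lemma mpoly_mult_left_cancel:
  fixes f g h :: "('n::finite, 'k::idom) mpoly"
  assumes "f \<noteq> 0" "f * g = f * h"
  shows "g = h"
  using mpoly_no_zero_divisors[of f "g - h"] assms by (simp add: algebra_simps)

section \<open>Evaluation at points and substitution of polynomials\<close>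

definition mono_eval :: "('k \<Rightarrow> 'r) \<Rightarrow> ('n \<Rightarrow> 'r) \<Rightarrow> ('n::finite \<Rightarrow>\<^sub>0 nat) \<Rightarrow> 'k \<Rightarrow> 'r::comm_ring_1" where
  "mono_eval \<phi> g m c = \<phi> c * (\<Prod>i\<in>UNIV. g i ^ lookup m i)"

lemma pm_hom_mono_eval:
  fixes \<phi> :: "'k::comm_ring_1 \<Rightarrow> 'r::comm_ring_1"
  assumes "\<And>a b. \<phi> (a + b) = \<phi> a + \<phi> b" "\<phi> 1 = 1" "\<And>a b. \<phi> (a * b) = \<phi> a * \<phi> b"
  shows "pm_hom (mono_eval \<phi> g)"
  by unfold_locales
    (simp_all add: mono_eval_def assms distrib_right lookup_add power_add prod.distrib mult_ac)

lemma mconst_add: "mconst (a + b) = mconst a + mconst b"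
  and mconst_mult: "mconst (a * b) = mconst a * mconst b"
  and mconst_0 [simp]: "mconst 0 = 0"
  and mconst_1 [simp]: "mconst 1 = 1"
  and mconst_eq_iff [simp]: "mconst a = mconst b \<longleftrightarrow> a = b"
  by (simp_all add: mconst_def single_add mult_single) (metis lookup_single_eq)

lemma mconst_eq_0_iff [simp]: "mconst a = 0 \<longleftrightarrow> a = 0"
  using mconst_eq_iff[of a 0] by simp

lemma mono_eval_single_var:
  "mono_eval \<phi> g (single i 1) c = \<phi> c * g i"
proof -
  have "(\<Prod>j\<in>UNIV. g j ^ lookup (single i (1::nat)) j) = (\<Prod>j\<in>UNIV. if i = j then g j else 1)"
    by (intro prod.cong) (auto simp: lookup_single when_def)
  then show ?thesis
    by (simp add: mono_eval_def prod.delta)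
qed

definition poly_eval :: "'k ^ 'n \<Rightarrow> ('n::finite, 'k::comm_ring_1) mpoly \<Rightarrow> 'k" where
  "poly_eval p = pm_ext (mono_eval id (\<lambda>i. p $ i))"

interpretation ev: pm_hom "mono_eval id (\<lambda>i. p $ i)" for p :: "'k::comm_ring_1 ^ 'n"
  by (rule pm_hom_mono_eval) simp_all

lemmas poly_eval_simps =
  ev.ext_zero[folded poly_eval_def] ev.ext_one[folded poly_eval_def]
  ev.ext_add[folded poly_eval_def] ev.ext_diff[folded poly_eval_def]
  ev.ext_sum[folded poly_eval_def] ev.ext_mult[folded poly_eval_def]
  ev.ext_prod[folded poly_eval_def]

lemma poly_eval_mconst [simp]: "poly_eval p (mconst c) = c"
  unfolding poly_eval_def mconst_def ev.ext_single by (simp add: mono_eval_def)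

lemma poly_eval_mvar [simp]: "poly_eval p (mvar i) = p $ i"
  unfolding poly_eval_def mvar_def ev.ext_single mono_eval_single_var by simp

lemma poly_eval_lin_form: "poly_eval p (lin_form a) = lin_eval a p"
  by (simp add: lin_form_def lin_eval_def poly_eval_simps)

definition poly_subst :: "('n \<Rightarrow> ('n, 'k) mpoly) \<Rightarrow> ('n::finite, 'k::comm_ring_1) mpoly \<Rightarrow> ('n, 'k) mpoly" where
  "poly_subst g = pm_ext (mono_eval mconst g)"

interpretation sub: pm_hom "mono_eval mconst g" for g :: "'n::finite \<Rightarrow> ('n, 'k::comm_ring_1) mpoly"
  by (rule pm_hom_mono_eval) (simp_all add: mconst_add mconst_mult)

lemmas poly_subst_simps =
  sub.ext_zero[folded poly_subst_def] sub.ext_one[folded poly_subst_def]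
  sub.ext_add[folded poly_subst_def] sub.ext_diff[folded poly_subst_def]
  sub.ext_sum[folded poly_subst_def] sub.ext_mult[folded poly_subst_def]
  sub.ext_prod[folded poly_subst_def] sub.ext_power[folded poly_subst_def]

lemmas poly_subst_dvd = sub.ext_dvd[folded poly_subst_def]

lemma poly_subst_mconst [simp]: "poly_subst g (mconst c) = mconst c"
  unfolding poly_subst_def mconst_def sub.ext_single by (simp add: mono_eval_def mconst_def)

lemma poly_subst_mvar [simp]: "poly_subst g (mvar i) = g i"
  unfolding poly_subst_def mvar_def sub.ext_single mono_eval_single_var by simp

text \<open>Constants and variables generate the polynomial ring. The rule serves for properties
  stable under sums and products, such as congruence modulo a linear form.\<close>

lemma mpoly_induct [case_names const var add mult]:
  fixes f :: "('n::finite, 'k::comm_ring_1) mpoly"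
  assumes const: "\<And>c. P (mconst c)" and var: "\<And>i. P (mvar i)"
    and add: "\<And>f g. P f \<Longrightarrow> P g \<Longrightarrow> P (f + g)"
    and mult: "\<And>f g. P f \<Longrightarrow> P g \<Longrightarrow> P (f * g)"
  shows "P f"
proof -
  have P1: "P 1" using const[of 1] by simp
  have power: "P (mvar i ^ k)" for i k
    by (induction k) (auto intro: P1 mult var)
  have prod: "P (prod g I)" if "\<And>i. P (g i)" for g :: "'n \<Rightarrow> _" and I
    by (induction I rule: infinite_finite_induct) (auto intro: P1 mult that)
  have sum: "P (sum g I)" if "\<And>i. P (g i)" for g :: "('n \<Rightarrow>\<^sub>0 nat) \<Rightarrow> _" and I
    by (induction I rule: infinite_finite_induct) (use const[of 0] in \<open>auto intro: add that\<close>)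
  have pw: "mvar i ^ k = (single (single i k) 1 :: ('n, 'k) mpoly)" for i k
    by (induction k) (simp_all add: mvar_def mult_single single_add[symmetric])
  have pr: "(\<Prod>i\<in>I. single (g i) 1) = (single (sum g I) 1 :: ('n, 'k) mpoly)"
    for I :: "'n set" and g
    by (induction I rule: infinite_finite_induct) (simp_all add: mult_single)
  have "m = (\<Sum>i\<in>UNIV. single i (lookup m i))" for m :: "'n \<Rightarrow>\<^sub>0 nat"
    by (rule poly_mapping_eqI) (simp add: lookup_sum lookup_single when_def)
  then have mono: "single m c = mconst c * (\<Prod>i\<in>UNIV. mvar i ^ lookup m i)"
    for m :: "'n \<Rightarrow>\<^sub>0 nat" and c :: 'k
    by (simp add: pw pr mconst_def mult_single)
  have "P (\<Sum>m\<in>keys f. single m (lookup f m))"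
    unfolding mono by (intro sum mult const prod power)
  then show ?thesis by (simp add: sum_single_lookup)
qed

section \<open>Total degree and homogeneous components\<close>

definition mdeg :: "('n::finite \<Rightarrow>\<^sub>0 nat) \<Rightarrow> nat" where
  "mdeg m = (\<Sum>i\<in>UNIV. lookup m i)"

lemma mdeg_add: "mdeg (m + m') = mdeg m + mdeg m'"
  by (simp add: mdeg_def lookup_add sum.distrib)

lemma mhomogeneous_iff: "mhomogeneous d p \<longleftrightarrow> (\<forall>m. lookup p m \<noteq> 0 \<longrightarrow> mdeg m = d)"
  by (auto simp: mhomogeneous_def mdeg_def in_keys_iff)

definition hcomp_mono :: "nat \<Rightarrow> ('n::finite \<Rightarrow>\<^sub>0 nat) \<Rightarrow> 'k::comm_ring_1 \<Rightarrow> ('n, 'k) mpoly" where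
  "hcomp_mono d m c = (if mdeg m = d then single m c else 0)"

definition hcomp :: "nat \<Rightarrow> ('n::finite, 'k::comm_ring_1) mpoly \<Rightarrow> ('n, 'k) mpoly" where
  "hcomp d = pm_ext (hcomp_mono d)"

interpretation hc: pm_additive "hcomp_mono d"
  by unfold_locales (simp add: hcomp_mono_def single_add)

lemmas hcomp_simps =
  hc.ext_zero[folded hcomp_def] hc.ext_add[folded hcomp_def] hc.ext_diff[folded hcomp_def]
  hc.ext_sum[folded hcomp_def]

lemma lookup_hcomp: "lookup (hcomp d f) m = (if mdeg m = d then lookup f m else 0)"
proof -
  have "lookup (hcomp d f) m = (\<Sum>m'\<in>keys f. if m' = m then (if mdeg m = d then lookup f m else 0) else 0)"
    unfolding hcomp_def pm_ext_def lookup_sum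
    by (intro sum.cong) (auto simp: hcomp_mono_def lookup_single when_def)
  then show ?thesis
    by (simp add: in_keys_iff)
qed

lemma mhomogeneous_hcomp: "mhomogeneous d (hcomp d f)"
  by (auto simp: mhomogeneous_iff lookup_hcomp)

lemma hcomp_mhomogeneous: "mhomogeneous d f \<Longrightarrow> hcomp e f = (if e = d then f else 0)"
  by (rule poly_mapping_eqI) (auto simp: mhomogeneous_iff lookup_hcomp)

lemma mhomogeneous_0 [simp]: "mhomogeneous d 0"
  by (simp add: mhomogeneous_iff)

lemma mhomogeneous_add: "mhomogeneous d f \<Longrightarrow> mhomogeneous d g \<Longrightarrow> mhomogeneous d (f + g)"
  unfolding mhomogeneous_iff lookup_add by (metis add.right_neutral)

lemma mhomogeneous_diff: "mhomogeneous d f \<Longrightarrow> mhomogeneous d g \<Longrightarrow> mhomogeneous d (f - g)"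
  unfolding mhomogeneous_iff lookup_minus by (metis diff_zero)

lemma mhomogeneous_sum: "(\<And>i. i \<in> I \<Longrightarrow> mhomogeneous d (f i)) \<Longrightarrow> mhomogeneous d (sum f I)"
  by (induction I rule: infinite_finite_induct) (simp_all add: mhomogeneous_add)

lemma mhomogeneous_mult:
  assumes "mhomogeneous d f" "mhomogeneous e g"
  shows "mhomogeneous (d + e) (f * g)"
proof -
  have "mdeg m = d + e" if m: "m \<in> keys (f * g)" for m
  proof -
    obtain a b where "a \<in> keys f" "b \<in> keys g" "m = a + b"
      using m keys_mult[of f g] by blast
    then show ?thesis
      using assms by (simp add: mhomogeneous_iff in_keys_iff mdeg_add)
  qed
  then show ?thesis
    by (auto simp: mhomogeneous_iff in_keys_iff)
qed

lemma mhomogeneous_mconst: "mhomogeneous 0 (mconst c)"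
  by (auto simp: mhomogeneous_iff mconst_def lookup_single when_def mdeg_def)

lemma mhomogeneous_1 [simp]: "mhomogeneous 0 1"
  using mhomogeneous_mconst[of 1] by simp

lemma mhomogeneous_mvar: "mhomogeneous 1 (mvar i)"
  by (auto simp: mhomogeneous_iff mvar_def lookup_single when_def mdeg_def)

lemma mhomogeneous_mconst_mult: "mhomogeneous d f \<Longrightarrow> mhomogeneous d (mconst c * f)"
  using mhomogeneous_mult[OF mhomogeneous_mconst] by fastforce

lemma mhomogeneous_lin_form: "mhomogeneous 1 (lin_form a)"
  unfolding lin_form_def by (intro mhomogeneous_sum mhomogeneous_mconst_mult mhomogeneous_mvar)

lemma mhomogeneous_power: "mhomogeneous d f \<Longrightarrow> mhomogeneous (n * d) (f ^ n)"
  by (induction n) (simp_all add: mhomogeneous_mult)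

lemma mhomogeneous_prod:
  "(\<And>i. i \<in> I \<Longrightarrow> mhomogeneous (d i) (f i)) \<Longrightarrow> mhomogeneous (\<Sum>i\<in>I. d i) (\<Prod>i\<in>I. f i)"
  by (induction I rule: infinite_finite_induct) (simp_all add: mhomogeneous_mult)

text \<open>Only the trivial monomial has degree 0. In the base changes below this turns a
  coefficient of degree 0 into a scalar, invertible once it is nonzero.\<close>

lemma mhomogeneous_0_const:
  assumes "mhomogeneous 0 f"
  shows "f = mconst (lookup f 0)"
proof (rule poly_mapping_eqI)
  fix m
  show "lookup f m = lookup (mconst (lookup f 0)) m"
  proof (cases "m = 0")
    case False
    then have "mdeg m \<noteq> 0"
      by (auto simp: mdeg_def intro: poly_mapping_eqI)
    then show ?thesis
      using assms False by (auto simp: mhomogeneous_iff mconst_def lookup_single when_def)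
  qed (simp add: mconst_def)
qed

text \<open>Multiplication by \<open>B\<close> shifts degrees by \<open>d\<close>, as is seen on the
  monomials of \<open>c\<close>. The case \<open>e < d\<close> stands apart because the truncated
  \<open>e - d\<close> would select the constant term.\<close>

lemma hcomp_mult:
  assumes "mhomogeneous d B"
  shows "hcomp e (c * B) = (if e < d then 0 else hcomp (e - d) c * B)"
proof -
  have "hcomp e (single m a * B) = (if mdeg m + d = e then single m a * B else 0)" for m a
  proof -
    have "mhomogeneous (mdeg m) (single m a)"
      by (auto simp: mhomogeneous_iff lookup_single when_def)
    from hcomp_mhomogeneous[OF mhomogeneous_mult[OF this assms]] show ?thesis by auto
  qed
  then have "hcomp e ((\<Sum>m\<in>keys c. single m (lookup c m)) * B)
      = (\<Sum>m\<in>keys c. if mdeg m + d = e then single m (lookup c m) * B else 0)"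
    by (simp add: sum_distrib_right hcomp_simps)
  then have *: "hcomp e (c * B) = (\<Sum>m\<in>keys c. if mdeg m + d = e then single m (lookup c m) * B else 0)"
    by (simp add: sum_single_lookup)
  show ?thesis
  proof (cases "e < d")
    case False
    then have "hcomp (e - d) c * B = (\<Sum>m\<in>keys c. if mdeg m + d = e then single m (lookup c m) * B else 0)"
      unfolding hcomp_def pm_ext_def sum_distrib_right
      by (intro sum.cong) (auto simp: hcomp_mono_def)
    with False * show ?thesis by simp
  qed (use * in simp)
qed

section \<open>Linear forms are prime\<close>

lemma lin_form_add: "lin_form (a + b) = lin_form a + lin_form b"
  and lin_form_diff: "lin_form (a - b) = lin_form a - lin_form b"
  and lin_form_scale: "lin_form (c *s a) = mconst c * lin_form a"
  and lin_form_0 [simp]: "lin_form 0 = 0"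
  by (simp_all add: lin_form_conv_single single_add single_diff sum.distrib sum_subtractf mconst_def
      sum_distrib_left mult_single)

lemma lin_form_eq_iff: "lin_form a = lin_form b \<longleftrightarrow> a = b"
proof
  assume "lin_form a = lin_form b"
  then have "mconst (a $ i) = mconst (b $ i)" for i
    using mpdiff_lin_form[of i a] mpdiff_lin_form[of i b] by simp
  then show "a = b"
    by (simp add: vec_eq_iff)
qed simp

lemma lin_form_eq_0_iff [simp]: "lin_form a = 0 \<longleftrightarrow> a = 0"
  using lin_form_eq_iff[of a 0] by simp

lemma lin_eval_axis: "lin_eval a (axis i 1) = a $ i"
  by (simp add: lin_eval_def axis_def if_distrib cong: if_cong)

lemma lin_eval_linear:
  "lin_eval a (v + w) = lin_eval a v + lin_eval a w"
  "lin_eval a (v - w) = lin_eval a v - lin_eval a w"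
  "lin_eval a (c *s v) = c * lin_eval a v"
  "lin_eval (a + b) v = lin_eval a v + lin_eval b v"
  "lin_eval (a - b) v = lin_eval a v - lin_eval b v"
  "lin_eval (c *s a) v = c * lin_eval a v"
  "lin_eval 0 v = 0"
  by (simp_all add: lin_eval_def algebra_simps sum.distrib sum_subtractf sum_distrib_left)

lemma lin_eval_sum: "lin_eval (sum f I) v = (\<Sum>i\<in>I. lin_eval (f i) v)"
  by (induction I rule: infinite_finite_induct) (simp_all add: lin_eval_linear)

text \<open>For \<open>a $ i \<noteq> 0\<close>, \<open>elim_var a i\<close> solves the equation \<open>lin_form a = 0\<close> for the variable \<open>i\<close>;
  its image is a copy of \<open>S / S \<alpha>\<close> inside \<open>S\<close>.\<close>

definition elim_var :: "'k::field ^ 'n \<Rightarrow> 'n \<Rightarrow> ('n, 'k) mpoly \<Rightarrow> ('n, 'k) mpoly" where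
  "elim_var a i = poly_subst (\<lambda>j. if j = i then mvar i - mconst (inverse (a $ i)) * lin_form a else mvar j)"

lemma elim_var_simps:
  "elim_var a i 1 = 1"
  "elim_var a i (f + g) = elim_var a i f + elim_var a i g"
  "elim_var a i (f - g) = elim_var a i f - elim_var a i g"
  "elim_var a i (f * g) = elim_var a i f * elim_var a i g"
  "elim_var a i (f ^ n) = elim_var a i f ^ n"
  "elim_var a i (sum F I) = (\<Sum>j\<in>I. elim_var a i (F j))"
  "elim_var a i (prod F I) = (\<Prod>j\<in>I. elim_var a i (F j))"
  by (simp_all add: elim_var_def poly_subst_simps)

lemma elim_var_dvd: "f dvd g \<Longrightarrow> elim_var a i f dvd elim_var a i g"
  unfolding elim_var_def by (rule poly_subst_dvd)

lemma elim_var_mconst [simp]: "elim_var a i (mconst c) = mconst c"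
  by (simp add: elim_var_def)

lemma elim_var_lin_form: "elim_var a i (lin_form b) = lin_form (b - (b $ i / a $ i) *s a)"
proof -
  have "elim_var a i (lin_form b) =
      (\<Sum>j\<in>UNIV. mconst (b $ j) * (if j = i then mvar i - mconst (inverse (a $ i)) * lin_form a else mvar j))"
    by (simp add: lin_form_def[of b] elim_var_simps) (simp add: elim_var_def)
  also have "\<dots> = (\<Sum>j\<in>UNIV. mconst (b $ j) * mvar j -
      (if j = i then mconst (b $ i * inverse (a $ i)) * lin_form a else 0))"
    by (intro sum.cong) (auto simp: algebra_simps mconst_mult)
  also have "\<dots> = lin_form b - mconst (b $ i * inverse (a $ i)) * lin_form a"
    by (simp add: sum_subtractf lin_form_def[of b])
  finally show ?thesis
    by (simp add: lin_form_diff lin_form_scale divide_inverse)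
qed

lemma elim_var_self: "a $ i \<noteq> 0 \<Longrightarrow> elim_var a i (lin_form a) = 0"
  by (simp add: elim_var_lin_form)

text \<open>Each variable changes by a multiple of \<open>lin_form a\<close>, and congruence modulo
  an ideal respects sums and products.\<close>

lemma dvd_diff_elim_var: "lin_form a dvd f - elim_var a i f"
proof (induction f rule: mpoly_induct)
  case (var j)
  then show ?case by (simp add: elim_var_def)
next
  case (add f g)
  have "f + g - elim_var a i (f + g) = (f - elim_var a i f) + (g - elim_var a i g)"
    by (simp add: elim_var_simps)
  with add show ?case by (metis dvd_add)
next
  case (mult f g)
  have "f * g - elim_var a i (f * g) = (f - elim_var a i f) * g + elim_var a i f * (g - elim_var a i g)"
    by (simp add: elim_var_simps algebra_simps)
  with mult show ?case by (metis dvd_add dvd_mult dvd_mult2)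
qed simp

text \<open>The form is sent to zero and every polynomial is congruent to its image, so the kernel
  of the substitution is the ideal of the form.\<close>

lemma lin_form_dvd_iff_elim_var:
  assumes "a $ i \<noteq> 0"
  shows "lin_form a dvd f \<longleftrightarrow> elim_var a i f = 0"
proof
  assume "lin_form a dvd f"
  then have "elim_var a i (lin_form a) dvd elim_var a i f"
    by (rule elim_var_dvd)
  then show "elim_var a i f = 0"
    by (simp add: elim_var_self assms)
next
  assume "elim_var a i f = 0"
  then show "lin_form a dvd f"
    using dvd_diff_elim_var[of a f i] by simp
qed

text \<open>By \<open>elim_var\<close>, the quotient by the form embeds into a polynomial ring,
  which has no zero divisors.\<close>

lemma lin_form_dvd_mult:
  assumes "a \<noteq> 0" "lin_form a dvd f * g"
  shows "lin_form a dvd f \<or> lin_form a dvd g"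
proof -
  obtain i where i: "a $ i \<noteq> 0"
    using assms(1) by (auto simp: vec_eq_iff)
  have "elim_var a i f * elim_var a i g = 0"
    using assms(2) by (simp add: lin_form_dvd_iff_elim_var[OF i] elim_var_simps)
  then show ?thesis
    unfolding lin_form_dvd_iff_elim_var[OF i] by (rule mpoly_no_zero_divisors)
qed

lemma lin_form_dvd_lin_form:
  assumes "a \<noteq> 0" "lin_form a dvd lin_form b"
  obtains t where "b = t *s a"
proof -
  obtain i where i: "a $ i \<noteq> 0"
    using assms(1) by (auto simp: vec_eq_iff)
  have "b = (b $ i / a $ i) *s a"
    using assms(2) by (simp add: lin_form_dvd_iff_elim_var[OF i] elim_var_lin_form)
  then show thesis by (rule that)
qed

lemma lin_form_not_dvd_1:
  assumes "a \<noteq> 0"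
  shows "\<not> lin_form a dvd 1"
proof -
  obtain i where i: "a $ i \<noteq> 0"
    using assms by (auto simp: vec_eq_iff)
  show ?thesis
    by (simp add: lin_form_dvd_iff_elim_var[OF i] elim_var_simps)
qed

lemma lin_form_dvd_prod:
  assumes "a \<noteq> 0" "lin_form a dvd prod f I" "finite I"
  shows "\<exists>i\<in>I. lin_form a dvd f i"
  using assms(3,2)
proof (induction I)
  case empty
  then show ?case using lin_form_not_dvd_1[OF assms(1)] by simp
next
  case (insert i I)
  then show ?case using lin_form_dvd_mult[OF assms(1)] by auto
qed

lemma lin_form_dvd_power:
  assumes "a \<noteq> 0" "lin_form a dvd f ^ n"
  shows "lin_form a dvd f"
  using lin_form_dvd_prod[OF assms(1), of "\<lambda>_. f" "{..<n}"] assms(2) by auto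

text \<open>One factor is stripped at a time: after cancelling the \<open>n\<close> factors already
  found in \<open>g\<close>, primality puts the next one into the cofactor.\<close>

lemma lin_form_power_dvd_mult:
  assumes "a \<noteq> 0" "\<not> lin_form a dvd f" "lin_form a ^ n dvd f * g"
  shows "lin_form a ^ n dvd g"
  using assms(3)
proof (induction n)
  case (Suc n)
  have "lin_form a ^ n dvd f * g"
    using Suc.prems by (metis dvd_mult_right power_Suc)
  then obtain k where k: "g = lin_form a ^ n * k"
    using Suc.IH by (auto elim: dvdE)
  obtain r where r: "f * g = lin_form a ^ Suc n * r"
    using Suc.prems by (auto elim: dvdE)
  have "lin_form a ^ n \<noteq> 0"
  proof (induction n)
    case (Suc n)
    then show ?case using mpoly_no_zero_divisors[of "lin_form a" "lin_form a ^ n"] assms(1) by auto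
  qed simp
  moreover have "lin_form a ^ n * (f * k) = lin_form a ^ n * (lin_form a * r)"
    using r k by (simp add: mult_ac)
  ultimately have "f * k = lin_form a * r"
    by (rule mpoly_mult_left_cancel)
  then have "lin_form a dvd k"
    using lin_form_dvd_mult[OF assms(1), of f k] assms(2) by auto
  then show ?case
    unfolding k power_Suc2 by (rule mult_dvd_mono[OF dvd_refl])
qed simp

text \<open>Pairwise non-proportional linear forms are non-associated primes. The powers are
  collected one by one: the product found so far is not divisible by the new form, so the whole new
  power divides the cofactor.\<close>

lemma prod_lin_form_power_dvd:
  assumes "finite I" "\<And>i. i \<in> I \<Longrightarrow> v i \<noteq> 0" "\<And>i. i \<in> I \<Longrightarrow> lin_form (v i) ^ n i dvd f"
    and "\<And>i j t. i \<in> I \<Longrightarrow> j \<in> I \<Longrightarrow> i \<noteq> j \<Longrightarrow> v i \<noteq> t *s v j"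
  shows "(\<Prod>i\<in>I. lin_form (v i) ^ n i) dvd f"
  using assms
proof (induction I)
  case (insert i I)
  have "(\<Prod>i\<in>I. lin_form (v i) ^ n i) dvd f"
    using insert by blast
  then obtain g where g: "f = (\<Prod>i\<in>I. lin_form (v i) ^ n i) * g"
    by (auto elim: dvdE)
  have vi: "v i \<noteq> 0" using insert by blast
  have "\<not> lin_form (v i) dvd (\<Prod>i\<in>I. lin_form (v i) ^ n i)"
  proof
    assume "lin_form (v i) dvd (\<Prod>i\<in>I. lin_form (v i) ^ n i)"
    then obtain j where j: "j \<in> I" "lin_form (v i) dvd lin_form (v j) ^ n j"
      using lin_form_dvd_prod[OF vi] insert.hyps by blast
    then obtain t where "v j = t *s v i"
      using lin_form_dvd_lin_form[OF vi lin_form_dvd_power[OF vi]] by blast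
    then show False using insert j by blast
  qed
  moreover have "lin_form (v i) ^ n i dvd (\<Prod>i\<in>I. lin_form (v i) ^ n i) * g"
    using insert.prems(2)[of i] g by simp
  ultimately have "lin_form (v i) ^ n i dvd g"
    by (rule lin_form_power_dvd_mult[OF vi])
  then show ?case
    using insert.hyps by (simp add: g mult.commute mult_dvd_mono)
qed simp

section \<open>Terao's polynomial\<close>

abbreviation dv :: "('k::field ^ 'n) set \<Rightarrow> 'k ^ 'n" where "dv \<equiv> defining_vec"

lemma mem_hyperplane_iff: "hyperplane H \<Longrightarrow> v \<in> H \<longleftrightarrow> lin_eval (dv H) v = 0"
  using lin_eval_defining_vec by blast

lemma hyperplane_subset_eq:
  assumes "hyperplane H" "hyperplane K" "H \<subseteq> K"
  shows "H = K"
  using assms by (intro vec.subspace_dim_equal) (auto simp: hyperplane_def)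

lemma defining_vec_nonzero:
  fixes H :: "('k::field ^ 'n) set"
  assumes "hyperplane H"
  shows "dv H \<noteq> 0"
proof
  assume "dv H = 0"
  then have "H = UNIV"
    using mem_hyperplane_iff[OF assms] by (auto simp: lin_eval_linear)
  then have "vec.dim H = CARD('n)"
    by (simp add: card_cart_basis)
  with assms show False
    by (simp add: hyperplane_def)
qed

lemma defining_vec_multiple:
  assumes "hyperplane H" "hyperplane K" "dv H = t *s dv K"
  shows "H = K"
proof -
  have "K \<subseteq> H"
    using assms(3) by (auto simp: mem_hyperplane_iff[OF assms(1)] mem_hyperplane_iff[OF assms(2)] lin_eval_linear)
  then show ?thesis
    using hyperplane_subset_eq assms by blast
qed

text \<open>A form vanishing on \<open>H \<inter> K\<close> is a combination of the forms of
  \<open>H\<close> and \<open>K\<close>. The coefficient of the latter is nonzero because a point of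
  \<open>H\<close> outside \<open>K\<close> lies outside \<open>L\<close> too.\<close>

lemma defining_vec_pencil:
  fixes H K L :: "('k::field ^ 'n) set"
  assumes hyp: "hyperplane H" "hyperplane K" "hyperplane L"
    and "H \<noteq> K" "H \<noteq> L" "H \<inter> L = H \<inter> K"
  obtains s t where "dv L = s *s dv K + t *s dv H" "s \<noteq> 0"
proof -
  obtain w0 where w0: "w0 \<in> H" "w0 \<notin> K"
    using hyperplane_subset_eq[OF hyp(1,2)] assms(4) by blast
  obtain z0 where z0: "z0 \<in> K" "z0 \<notin> H"
    using hyperplane_subset_eq[OF hyp(2,1)] assms(4) by blast
  \<comment> \<open>\<open>w\<close> and \<open>z\<close> are dual to the forms of \<open>K\<close>
    and \<open>H\<close>; subtracting multiples of them moves any \<open>v\<close> into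
    \<open>H \<inter> K\<close>, hence into \<open>L\<close>.\<close>
  define w where "w = inverse (lin_eval (dv K) w0) *s w0"
  define z where "z = inverse (lin_eval (dv H) z0) *s z0"
  have w: "lin_eval (dv H) w = 0" "lin_eval (dv K) w = 1"
    using w0 by (simp_all add: w_def lin_eval_linear mem_hyperplane_iff[OF hyp(1)] mem_hyperplane_iff[OF hyp(2)])
  have z: "lin_eval (dv K) z = 0" "lin_eval (dv H) z = 1"
    using z0 by (simp_all add: z_def lin_eval_linear mem_hyperplane_iff[OF hyp(1)] mem_hyperplane_iff[OF hyp(2)])
  let ?s = "lin_eval (dv L) w" and ?t = "lin_eval (dv L) z"
  have "lin_eval (dv L) v = ?s * lin_eval (dv K) v + ?t * lin_eval (dv H) v" for v
  proof -
    let ?v = "v - lin_eval (dv K) v *s w - lin_eval (dv H) v *s z"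
    have "?v \<in> H" "?v \<in> K"
      using w z by (simp_all add: mem_hyperplane_iff[OF hyp(1)] mem_hyperplane_iff[OF hyp(2)] lin_eval_linear)
    then have "?v \<in> L" using assms(6) by blast
    then show ?thesis
      by (simp add: mem_hyperplane_iff[OF hyp(3)] lin_eval_linear algebra_simps)
  qed
  then have "dv L $ i = ?s * dv K $ i + ?t * dv H $ i" for i
    using lin_eval_axis[of _ i] by metis
  then have "dv L = ?s *s dv K + ?t *s dv H"
    by (simp add: vec_eq_iff)
  moreover have "?s \<noteq> 0"
  proof
    assume "?s = 0"
    then have "w \<in> H \<inter> L"
      using w by (simp add: mem_hyperplane_iff[OF hyp(1)] mem_hyperplane_iff[OF hyp(3)])
    then have "w \<in> K" using assms(6) by blast
    then show False using w by (simp add: mem_hyperplane_iff[OF hyp(2)])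
  qed
  ultimately show thesis by (rule that)
qed

section \<open>Derivations on linear forms and Terao's divisibility\<close>

lemma der_apply_lin_form_add:
  "der_apply \<theta> (lin_form (a + b)) = der_apply \<theta> (lin_form a) + der_apply \<theta> (lin_form b)"
  "der_apply \<theta> (lin_form (c *s a)) = mconst c * der_apply \<theta> (lin_form a)"
  by (simp_all add: der_apply_lin_form mconst_add mconst_mult algebra_simps sum.distrib sum_distrib_left)

lemma der_apply_add: "der_apply (\<theta> + \<eta>) f = der_apply \<theta> f + der_apply \<eta> f"
  and der_apply_diff: "der_apply (\<theta> - \<eta>) f = der_apply \<theta> f - der_apply \<eta> f"
  and der_apply_scale: "der_apply (g *s \<theta>) f = g * der_apply \<theta> f"
  and der_apply_0: "der_apply 0 f = 0"
  by (simp_all add: der_apply_def algebra_simps sum.distrib sum_subtractf sum_distrib_left)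

lemma der_apply_sum: "der_apply (sum \<theta> I) f = (\<Sum>i\<in>I. der_apply (\<theta> i) f)"
  by (induction I rule: infinite_finite_induct) (simp_all add: der_apply_0 der_apply_add)

lemma dvd_mconst_mult_cancel:
  fixes p f :: "('n::finite, 'k::field) mpoly"
  assumes "c \<noteq> 0" "p dvd mconst c * f"
  shows "p dvd f"
proof -
  have "mconst (inverse c) * (mconst c * f) = f"
    using assms(1) by (simp add: mult.assoc[symmetric] mconst_mult[symmetric])
  then show ?thesis
    using assms(2) by (metis dvd_mult)
qed

lemma log_der_dvd:
  "\<theta> \<in> log_der \<A> \<Longrightarrow> H \<in> \<A> \<Longrightarrow> lin_form (dv H) dvd der_apply \<theta> (lin_form (dv H))"
  by (auto simp: log_der_def defining_form_def)

text \<open>Write the hyperplanes of \<open>\<G>\<close> as \<open>s\<^sub>L \<beta> + t\<^sub>L \<alpha>\<close> with \<open>\<beta> = \<alpha>\<^sub>K\<close> and \<open>\<alpha> = \<alpha>\<^sub>H\<close>. If \<open>\<theta>(\<beta>) = \<beta> h\<close>,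
  then every \<open>\<alpha>\<^sub>L\<close> with \<open>L \<noteq> K\<close> divides \<open>\<theta>(\<alpha>) - \<alpha> h\<close>, and \<open>\<alpha>\<^sub>L\<close> is proportional to \<open>\<beta>\<close> modulo \<open>\<alpha>\<close>.\<close>

lemma pencil_power_dvd:
  fixes H K :: "('k::field ^ 'n) set"
  assumes "hyperplane H" "H \<notin> \<G>" "K \<in> \<G>" "finite \<G>" "\<And>L. L \<in> \<G> \<Longrightarrow> hyperplane L"
    and cap: "\<And>L. L \<in> \<G> \<Longrightarrow> H \<inter> L = H \<inter> K"
    and \<theta>: "\<theta> \<in> log_der \<G>" and i: "dv H $ i \<noteq> 0"
  shows "elim_var (dv H) i (lin_form (dv K)) ^ (card \<G> - 1)
    dvd elim_var (dv H) i (der_apply \<theta> (lin_form (dv H)))"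
proof -
  let ?a = "dv H" and ?b = "dv K"
  let ?f = "der_apply \<theta> (lin_form ?a)"
  have "\<exists>s t. dv L = s *s ?b + t *s ?a \<and> s \<noteq> 0" if "L \<in> \<G>" for L
    using defining_vec_pencil[of H K L] assms(1,2,3,5) cap that by metis
  then obtain s t where st: "\<And>L. L \<in> \<G> \<Longrightarrow> dv L = s L *s ?b + t L *s ?a" "\<And>L. L \<in> \<G> \<Longrightarrow> s L \<noteq> 0"
    by metis
  obtain h where h: "der_apply \<theta> (lin_form ?b) = lin_form ?b * h"
    using log_der_dvd[OF \<theta> \<open>K \<in> \<G>\<close>] by (auto elim: dvdE)
  have dvd: "lin_form (dv L) ^ 1 dvd ?f - lin_form ?a * h" if L: "L \<in> \<G> - {K}" for L
  proof -
    have "t L \<noteq> 0"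
    proof
      assume "t L = 0"
      then have "L = K"
        using defining_vec_multiple[of L K "s L"] st(1)[of L] L assms(3,5) by auto
      with L show False by blast
    qed
    moreover have "mconst (t L) * (?f - lin_form ?a * h) =
        der_apply \<theta> (lin_form (dv L)) - lin_form (dv L) * h"
    proof -
      have "der_apply \<theta> (lin_form (dv L)) = mconst (s L) * (lin_form ?b * h) + mconst (t L) * ?f"
        using L by (simp add: st(1)[of L] der_apply_lin_form_add h)
      moreover have "lin_form (dv L) = mconst (s L) * lin_form ?b + mconst (t L) * lin_form ?a"
        using L by (simp add: st(1)[of L] lin_form_add lin_form_scale)
      ultimately show ?thesis
        by (simp add: algebra_simps)
    qed
    moreover have "lin_form (dv L) dvd der_apply \<theta> (lin_form (dv L))"
      using log_der_dvd[OF \<theta>] L by blast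
    ultimately show ?thesis
      by (metis dvd_diff dvd_mconst_mult_cancel dvd_triv_left power_one_right)
  qed
  have "(\<Prod>L\<in>\<G> - {K}. lin_form (dv L) ^ 1) dvd ?f - lin_form ?a * h"
  proof (rule prod_lin_form_power_dvd)
    show "dv L \<noteq> u *s dv L'" if "L \<in> \<G> - {K}" "L' \<in> \<G> - {K}" "L \<noteq> L'" for L L' u
      using defining_vec_multiple[of L L' u] that assms(5) by blast
  qed (use assms(4,5) dvd defining_vec_nonzero in auto)
  \<comment> \<open>The substitution kills \<open>lin_form ?a * h\<close> and turns every remaining
    factor into a scalar multiple of the image of \<open>lin_form ?b\<close>.\<close>
  then have "elim_var ?a i (\<Prod>L\<in>\<G> - {K}. lin_form (dv L)) dvd elim_var ?a i (?f - lin_form ?a * h)"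
    by (simp add: elim_var_dvd)
  also have "elim_var ?a i (?f - lin_form ?a * h) = elim_var ?a i ?f"
    by (simp add: elim_var_simps elim_var_self i)
  also have "elim_var ?a i (\<Prod>L\<in>\<G> - {K}. lin_form (dv L))
      = (\<Prod>L\<in>\<G> - {K}. mconst (s L) * elim_var ?a i (lin_form ?b))"
    unfolding elim_var_simps
    by (intro prod.cong) (simp_all add: st(1) lin_form_add lin_form_scale elim_var_simps elim_var_self i)
  also have "\<dots> = (\<Prod>L\<in>\<G> - {K}. mconst (s L)) * elim_var ?a i (lin_form ?b) ^ (card \<G> - 1)"
    using assms(3,4) by (simp add: prod.distrib)
  finally show ?thesis
    by (metis dvd_mult_right)
qed

lemma restriction_insert:
  assumes "H \<notin> \<A>"
  shows "restriction (insert H \<A>) H = (\<inter>) H ` \<A>"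
  using assms by (auto simp: restriction_def)

text \<open>Group \<open>\<A>\<close> by the traces \<open>H \<inter> L\<close>. A class of size
  \<open>N\<close> contributes, modulo the form of \<open>H\<close>, the power \<open>N - 1\<close>
  of one form; different classes give non-proportional forms, so their product \<open>B\<close>
  divides modulo that form. Its degree is the number of hyperplanes minus the number of
  traces.\<close>

lemma terao_polynomial:
  fixes H :: "('k::field ^ 'n) set"
  assumes "arrangement \<A>" "hyperplane H" "H \<notin> \<A>"
  obtains B where "mhomogeneous (card \<A> - card (restriction (\<A> \<union> {H}) H)) B"
    "\<And>\<theta>. \<theta> \<in> log_der \<A> \<Longrightarrow>
      \<exists>c. lin_form (dv H) dvd der_apply \<theta> (lin_form (dv H)) - c * B"
proof -
  let ?a = "dv H"
  obtain i where i: "?a $ i \<noteq> 0"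
    using defining_vec_nonzero[OF assms(2)] by (auto simp: vec_eq_iff)
  have fin: "finite \<A>" and hyp: "\<And>L. L \<in> \<A> \<Longrightarrow> hyperplane L"
    using assms(1) by (auto simp: arrangement_def)
  let ?R = "(\<inter>) H ` \<A>"
  define G where "G = (\<lambda>Y. {L \<in> \<A>. H \<inter> L = Y})"
  define r where "r = (\<lambda>Y. SOME L. L \<in> G Y)"
  have r: "r Y \<in> \<A>" "H \<inter> r Y = Y" if "Y \<in> ?R" for Y
  proof -
    have "\<exists>L. L \<in> G Y" using that by (auto simp: G_def)
    then have "r Y \<in> G Y" unfolding r_def by (rule someI_ex)
    then show "r Y \<in> \<A>" "H \<inter> r Y = Y" by (auto simp: G_def)
  qed
  have finG: "finite (G Y)" for Y
    using fin by (auto simp: G_def)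
  define m where "m = (\<lambda>Y. card (G Y) - 1)"
  define B where "B = (\<Prod>Y\<in>?R. lin_form (dv (r Y)) ^ m Y)"
  \<comment> \<open>\<open>\<gamma> Y\<close> is the vector of the image of the representative form
    under \<open>elim_var ?a i\<close>.\<close>
  define \<gamma> where "\<gamma> = (\<lambda>Y. dv (r Y) - (dv (r Y) $ i / ?a $ i) *s ?a)"
  have sigma_r: "elim_var ?a i (lin_form (dv (r Y))) = lin_form (\<gamma> Y)" for Y
    by (simp add: \<gamma>_def elim_var_lin_form)
  have \<gamma>_nz: "\<gamma> Y \<noteq> 0" if "Y \<in> ?R" for Y
  proof
    assume "\<gamma> Y = 0"
    then have "dv (r Y) = (dv (r Y) $ i / ?a $ i) *s ?a"
      by (simp add: \<gamma>_def)
    then have "r Y = H"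
      by (rule defining_vec_multiple[OF hyp[OF r(1)[OF that]] assms(2)])
    then show False using r(1)[OF that] assms(3) by simp
  qed
  \<comment> \<open>Where \<open>?a\<close> vanishes, \<open>\<gamma> Y\<close> and
    \<open>dv (r Y)\<close> agree, so a proportionality of the images becomes an inclusion of the
    traces.\<close>
  have \<gamma>_subset: "Y' \<subseteq> Y" if "Y \<in> ?R" "Y' \<in> ?R" "\<gamma> Y = t *s \<gamma> Y'" for Y Y' t
  proof
    fix v assume "v \<in> Y'"
    then have v: "v \<in> H" "lin_eval ?a v = 0" "lin_eval (dv (r Y')) v = 0"
      using r[OF that(2)] mem_hyperplane_iff[OF assms(2)] mem_hyperplane_iff[OF hyp] by blast+
    have "lin_eval (\<gamma> Y) v = t * lin_eval (\<gamma> Y') v"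
      by (simp add: that(3) lin_eval_linear)
    then have "lin_eval (dv (r Y)) v = 0"
      using v by (simp add: \<gamma>_def lin_eval_linear)
    then show "v \<in> Y"
      using v(1) r[OF that(1)] mem_hyperplane_iff[OF hyp] by blast
  qed
  have \<gamma>_nonprop: "\<gamma> Y \<noteq> t *s \<gamma> Y'" if "Y \<in> ?R" "Y' \<in> ?R" "Y \<noteq> Y'" for Y Y' t
  proof
    assume eq: "\<gamma> Y = t *s \<gamma> Y'"
    then have "t \<noteq> 0" using \<gamma>_nz[OF that(1)] by auto
    then have "\<gamma> Y' = inverse t *s \<gamma> Y"
      by (simp add: eq)
    then show False
      using \<gamma>_subset eq that by (metis subset_antisym)
  qed
  show thesis
  proof (rule that)
    have "card \<A> = card (\<Union>Y\<in>?R. G Y)"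
      by (rule arg_cong[where f = card]) (auto simp: G_def)
    also have "\<dots> = (\<Sum>Y\<in>?R. card (G Y))"
      using fin by (intro card_UN_disjoint) (auto simp: G_def)
    finally have "card \<A> = (\<Sum>Y\<in>?R. card (G Y))" .
    moreover have "1 \<le> card (G Y)" if "Y \<in> ?R" for Y
      using r[OF that] finG[of Y] by (auto simp: G_def Suc_le_eq card_gt_0_iff)
    ultimately have "(\<Sum>Y\<in>?R. m Y) = card \<A> - card ?R"
      unfolding m_def by (subst sum_subtractf_nat) auto
    moreover have "mhomogeneous (\<Sum>Y\<in>?R. m Y * 1) B"
      unfolding B_def by (intro mhomogeneous_prod mhomogeneous_power mhomogeneous_lin_form)
    ultimately show "mhomogeneous (card \<A> - card (restriction (\<A> \<union> {H}) H)) B"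
      by (simp add: restriction_insert[OF assms(3)])
  next
    fix \<theta> assume \<theta>: "\<theta> \<in> log_der \<A>"
    let ?f = "der_apply \<theta> (lin_form ?a)"
    have pow: "lin_form (\<gamma> Y) ^ m Y dvd elim_var ?a i ?f" if "Y \<in> ?R" for Y
      unfolding m_def sigma_r[symmetric]
    proof (rule pencil_power_dvd)
      show "\<theta> \<in> log_der (G Y)"
        using \<theta> by (auto simp: log_der_def G_def)
    qed (use r[OF that] finG hyp i assms in \<open>auto simp: G_def\<close>)
    have "(\<Prod>Y\<in>?R. lin_form (\<gamma> Y) ^ m Y) dvd elim_var ?a i ?f"
      using finite_imageI[OF fin] \<gamma>_nz pow \<gamma>_nonprop by (rule prod_lin_form_power_dvd)
    moreover have "(\<Prod>Y\<in>?R. lin_form (\<gamma> Y) ^ m Y) = elim_var ?a i B"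
      by (simp add: B_def elim_var_simps sigma_r)
    ultimately obtain c where c: "elim_var ?a i ?f = elim_var ?a i B * c"
      by (auto elim: dvdE)
    \<comment> \<open>Both \<open>?f\<close> and \<open>B\<close> are congruent to their images
      modulo \<open>lin_form ?a\<close>, which lifts the divisibility of the images to a
      congruence.\<close>
    have "?f - c * B = (?f - elim_var ?a i ?f) - c * (B - elim_var ?a i B)"
      by (simp add: c algebra_simps)
    then show "\<exists>c. lin_form ?a dvd ?f - c * B"
      by (metis dvd_diff dvd_mult dvd_diff_elim_var)
  qed
qed

text \<open>Taking the component of degree \<open>e\<close> in \<open>f - c * B = g * l\<close>
  replaces \<open>c\<close> by its component of degree \<open>e - d\<close>, or by 0 if
  \<open>e < d\<close>.\<close>

lemma dvd_diff_mult_homogeneous: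
  fixes f B l :: "('n::finite, 'k::field) mpoly"
  assumes "mhomogeneous e f" "mhomogeneous d B" "mhomogeneous r l" "l dvd f - c * B"
  obtains c' where "mhomogeneous (e - d) c'" "e < d \<Longrightarrow> c' = 0" "l dvd f - c' * B"
proof
  let ?c = "if e < d then 0 else hcomp (e - d) c"
  obtain g where "f - c * B = g * l"
    using assms(4) by (metis dvdE mult.commute)
  then have "hcomp e (f - c * B) = hcomp e (g * l)" by simp
  then have "f - ?c * B = (if e < r then 0 else hcomp (e - r) g * l)"
    by (cases "e < d"; cases "e < r")
      (simp_all add: hcomp_simps hcomp_mult[OF assms(2)] hcomp_mult[OF assms(3)] hcomp_mhomogeneous[OF assms(1)])
  then show "l dvd f - ?c * B" by simp
qed (simp_all add: mhomogeneous_hcomp)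

section \<open>Module bases\<close>

text \<open>Families with coefficient functions, instead of sets, make base changes computations
  with finite sums; \<open>module_basis_iff\<close> gives the link to \<open>independent\<close> and
  \<open>span\<close>.\<close>

definition module_basis ::
  "'i set \<Rightarrow> ('n::finite, 'k::field) derivation set \<Rightarrow> ('i \<Rightarrow> ('n, 'k) derivation) \<Rightarrow> bool" where
  "module_basis I M \<theta> \<longleftrightarrow> \<theta> ` I \<subseteq> M \<and> (\<forall>x\<in>M. \<exists>f. x = (\<Sum>i\<in>I. f i *s \<theta> i)) \<and>
     (\<forall>f. (\<Sum>i\<in>I. f i *s \<theta> i) = 0 \<longrightarrow> (\<forall>i\<in>I. f i = 0))"

lemma module_basisI:
  assumes "\<And>i. i \<in> I \<Longrightarrow> \<theta> i \<in> M" "\<And>x. x \<in> M \<Longrightarrow> \<exists>f. x = (\<Sum>i\<in>I. f i *s \<theta> i)"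
    "\<And>f i. (\<Sum>i\<in>I. f i *s \<theta> i) = 0 \<Longrightarrow> i \<in> I \<Longrightarrow> f i = 0"
  shows "module_basis I M \<theta>"
  unfolding module_basis_def by (intro conjI ballI allI impI image_subsetI assms)

lemma module_basisD:
  assumes "module_basis I M \<theta>"
  shows "i \<in> I \<Longrightarrow> \<theta> i \<in> M" "x \<in> M \<Longrightarrow> \<exists>f. x = (\<Sum>i\<in>I. f i *s \<theta> i)"
    "(\<Sum>i\<in>I. f i *s \<theta> i) = 0 \<Longrightarrow> i \<in> I \<Longrightarrow> f i = 0"
  using assms unfolding module_basis_def by (simp_all add: image_subset_iff)

lemma module_basis_iff:
  assumes "finite I" "der.subspace M"
  shows "module_basis I M \<theta> \<longleftrightarrow> inj_on \<theta> I \<and> der.independent (\<theta> ` I) \<and> der.span (\<theta> ` I) = M"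
proof (intro iffI conjI)
  assume b: "module_basis I M \<theta>"
  note bD = module_basisD[OF b]
  have sum_if: "(\<Sum>i\<in>I. (if i = a then c else 0) *s \<theta> i) = c *s \<theta> a" if "a \<in> I" for a c
  proof -
    have "(\<Sum>i\<in>I. (if i = a then c else 0) *s \<theta> i) = (\<Sum>i\<in>I. if i = a then c *s \<theta> a else 0)"
      by (intro sum.cong) auto
    then show ?thesis using assms(1) that by simp
  qed
  show inj: "inj_on \<theta> I"
  proof (rule inj_onI, rule ccontr)
    fix a b assume ab: "a \<in> I" "b \<in> I" "\<theta> a = \<theta> b" "a \<noteq> b"
    \<comment> \<open>Two equal members would satisfy the nontrivial relation with coefficients 1
      and -1.\<close>
    let ?f = "\<lambda>i. (if i = a then 1 else 0) - (if i = b then 1 else 0)"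
    have "(\<Sum>i\<in>I. ?f i *s \<theta> i) = 0"
      using ab by (simp only: der.scale_left_diff_distrib sum_subtractf sum_if) simp
    from bD(3)[OF this ab(1)] ab(4) show False by simp
  qed
  have reindex: "(\<Sum>v\<in>\<theta> ` I. u v *s v) = (\<Sum>i\<in>I. u (\<theta> i) *s \<theta> i)" for u
    using inj by (simp add: sum.reindex)
  show "der.independent (\<theta> ` I)"
    unfolding der.dependent_finite[OF finite_imageI[OF assms(1)]] reindex
    using bD(3)[of "\<lambda>i. u (\<theta> i)" for u] by blast
  show "der.span (\<theta> ` I) = M"
  proof
    show "der.span (\<theta> ` I) \<subseteq> M"
      using bD(1) assms(2) by (intro der.span_minimal) auto
    show "M \<subseteq> der.span (\<theta> ` I)"
    proof
      fix x assume "x \<in> M"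
      then obtain f where "x = (\<Sum>i\<in>I. f i *s \<theta> i)" using bD(2) by blast
      then show "x \<in> der.span (\<theta> ` I)"
        by (simp add: der.span_sum der.span_scale der.span_base)
    qed
  qed
next
  assume "inj_on \<theta> I \<and> der.independent (\<theta> ` I) \<and> der.span (\<theta> ` I) = M"
  then have inj: "inj_on \<theta> I" and ind: "der.independent (\<theta> ` I)" and span: "der.span (\<theta> ` I) = M"
    by auto
  have reindex: "(\<Sum>v\<in>\<theta> ` I. u v *s v) = (\<Sum>i\<in>I. u (\<theta> i) *s \<theta> i)" for u
    using inj by (simp add: sum.reindex)
  show "module_basis I M \<theta>"
  proof (rule module_basisI)
    show "\<theta> i \<in> M" if "i \<in> I" for i
      using that span der.span_base by blast
    show "\<exists>f. x = (\<Sum>i\<in>I. f i *s \<theta> i)" if "x \<in> M" for x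
    proof -
      obtain u where "x = (\<Sum>v\<in>\<theta> ` I. u v *s v)"
        using \<open>x \<in> M\<close> span der.span_finite[OF finite_imageI[OF assms(1)]] by blast
      then show ?thesis
        unfolding reindex by (rule exI[where x = "\<lambda>i. u (\<theta> i)"])
    qed
    show "f i = 0" if f: "(\<Sum>i\<in>I. f i *s \<theta> i) = 0" and i: "i \<in> I" for f i
    proof -
      let ?u = "\<lambda>v. f (the_inv_into I \<theta> v)"
      have "(\<Sum>v\<in>\<theta> ` I. ?u v *s v) = 0"
        unfolding reindex using f inj by (simp add: the_inv_into_f_f)
      then have "?u (\<theta> i) = 0"
        using i by (rule der.independentD[OF ind finite_imageI[OF assms(1)] subset_refl _ imageI])
      then show ?thesis
        using inj i by (simp add: the_inv_into_f_f)
    qed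
  qed
qed

lemma module_basis_permute:
  assumes "module_basis I M \<theta>" "p permutes I"
  shows "module_basis I M (\<theta> \<circ> p)"
proof (rule module_basisI)
  note bD = module_basisD[OF assms(1)]
  have p_inv: "p (inv p i) = i" "inv p (p i) = i" for i
    using permutes_inverses[OF assms(2)] by auto
  have reindex: "(\<Sum>i\<in>I. f i *s (\<theta> \<circ> p) i) = (\<Sum>i\<in>I. f (inv p i) *s \<theta> i)" for f
    using sum.permute[OF assms(2), of "\<lambda>i. f (inv p i) *s \<theta> i"] by (simp add: o_def p_inv)
  show "(\<theta> \<circ> p) i \<in> M" if "i \<in> I" for i
    using bD(1) that permutes_in_image[OF assms(2)] by simp
  show "\<exists>f. x = (\<Sum>i\<in>I. f i *s (\<theta> \<circ> p) i)" if x: "x \<in> M" for x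
  proof -
    obtain f where "x = (\<Sum>i\<in>I. f i *s \<theta> i)" using bD(2)[OF x] by blast
    then have "x = (\<Sum>i\<in>I. f (p i) *s (\<theta> \<circ> p) i)" by (simp add: reindex p_inv del: o_apply)
    then show ?thesis by (rule exI[where x = "\<lambda>i. f (p i)"])
  qed
  show "f i = 0" if f: "(\<Sum>i\<in>I. f i *s (\<theta> \<circ> p) i) = 0" and i: "i \<in> I" for f i
  proof -
    have "p i \<in> I" using i permutes_in_image[OF assms(2)] by blast
    from bD(3)[OF f[unfolded reindex] this] show ?thesis by (simp only: p_inv)
  qed
qed

text \<open>A Steinitz exchange over a ring: since \<open>f i\<close> is a unit with inverse
  \<open>u\<close>, the replaced element is recovered from \<open>x\<close> and the others.\<close>

lemma module_basis_exchange:
  assumes "module_basis I M \<theta>" "finite I" "i \<in> I" "x \<in> M"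
    and x: "x = (\<Sum>k\<in>I. f k *s \<theta> k)" and unit: "u * f i = 1"
  shows "module_basis I M (\<theta>(i := x))"
proof (rule module_basisI)
  note bD = module_basisD[OF assms(1)]
  have x': "x = f i *s \<theta> i + (\<Sum>k\<in>I - {i}. f k *s \<theta> k)"
    unfolding x using assms(2,3) by (rule sum.remove)
  have sum_upd: "(\<Sum>k\<in>I. g k *s (\<theta>(i := x)) k) = g i *s x + (\<Sum>k\<in>I - {i}. g k *s \<theta> k)" for g
    using sum.remove[OF assms(2,3), of "\<lambda>k. g k *s (\<theta>(i := x)) k"] by simp
  show "(\<theta>(i := x)) k \<in> M" if "k \<in> I" for k
    using assms(4) bD(1) that by simp
  show "\<exists>g. y = (\<Sum>k\<in>I. g k *s (\<theta>(i := x)) k)" if "y \<in> M" for y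
  proof -
    obtain g where g: "y = (\<Sum>k\<in>I. g k *s \<theta> k)" using bD(2)[OF \<open>y \<in> M\<close>] by blast
    let ?c = "g i * u"
    have c: "?c * f i = g i" using unit by (simp add: mult.assoc)
    have "y = g i *s \<theta> i + (\<Sum>k\<in>I - {i}. g k *s \<theta> k)"
      unfolding g using assms(2,3) by (rule sum.remove)
    also have "\<dots> = ?c *s x + (\<Sum>k\<in>I - {i}. (g k - ?c * f k) *s \<theta> k)"
      unfolding x' der.scale_right_distrib der.scale_scale c der.scale_left_diff_distrib sum_subtractf
      by (simp add: der.scale_sum_right)
    also have "\<dots> = (\<Sum>k\<in>I. (if k = i then ?c else g k - ?c * f k) *s (\<theta>(i := x)) k)"
      unfolding sum_upd by (auto intro!: sum.cong)
    finally show ?thesis by (rule exI[where x = "\<lambda>k. if k = i then ?c else g k - ?c * f k"])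
  qed
  show "g k = 0" if g: "(\<Sum>k\<in>I. g k *s (\<theta>(i := x)) k) = 0" and k: "k \<in> I" for g k
  proof -
    \<comment> \<open>\<open>?h\<close> lists the coordinates of the given relation in the old
      basis.\<close>
    let ?h = "\<lambda>k. if k = i then g i * f i else g i * f k + g k"
    have "(\<Sum>k\<in>I. ?h k *s \<theta> k) = ?h i *s \<theta> i + (\<Sum>k\<in>I - {i}. ?h k *s \<theta> k)"
      using assms(2,3) by (rule sum.remove)
    also have "(\<Sum>k\<in>I - {i}. ?h k *s \<theta> k) = (\<Sum>k\<in>I - {i}. (g i * f k) *s \<theta> k + g k *s \<theta> k)"
      by (intro sum.cong) (auto simp: der.scale_left_distrib)
    also have "?h i *s \<theta> i + \<dots> = g i *s x + (\<Sum>k\<in>I - {i}. g k *s \<theta> k)"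
      unfolding x' by (simp add: der.scale_right_distrib der.scale_sum_right sum.distrib)
    finally have h: "(\<Sum>k\<in>I. ?h k *s \<theta> k) = 0"
      using g sum_upd by simp
    have "g i * f i = 0"
      using bD(3)[OF h assms(3)] by simp
    moreover have "u * (g i * f i) = g i * (u * f i)"
      by (rule mult.left_commute)
    ultimately have gi: "g i = 0"
      by (simp add: unit)
    show ?thesis
      using bD(3)[OF h k] gi by (simp split: if_splits)
  qed
qed

text \<open>Subtracting multiples of \<open>\<theta> i\<close> is undone by adding them back;
  \<open>g i = 0\<close> leaves \<open>\<theta> i\<close> itself in place.\<close>

lemma module_basis_eliminate:
  assumes "module_basis I M \<theta>" "finite I" "i \<in> I" "der.subspace M" "g i = 0"
  shows "module_basis I M (\<lambda>k. \<theta> k - g k *s \<theta> i)"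
proof (rule module_basisI)
  note bD = module_basisD[OF assms(1)]
  have collect: "(\<Sum>k\<in>I. f k *s (\<theta> k - g k *s \<theta> i))
      = (\<Sum>k\<in>I. (f k - (if k = i then (\<Sum>k\<in>I. f k * g k) else 0)) *s \<theta> k)" for f
  proof -
    have "(\<Sum>k\<in>I. (if k = i then (\<Sum>k\<in>I. f k * g k) else 0) *s \<theta> k)
        = (\<Sum>k\<in>I. if k = i then (\<Sum>k\<in>I. f k * g k) *s \<theta> i else 0)"
      by (intro sum.cong) auto
    then show ?thesis
      using assms(2,3) by (simp add: der.scale_right_diff_distrib der.scale_left_diff_distrib sum_subtractf
          der.scale_sum_left)
  qed
  show "\<theta> k - g k *s \<theta> i \<in> M" if "k \<in> I" for k
    using that bD(1) assms(3,4) by (simp add: der.subspace_diff der.subspace_scale)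
  show "\<exists>f. x = (\<Sum>k\<in>I. f k *s (\<theta> k - g k *s \<theta> i))" if "x \<in> M" for x
  proof -
    obtain f where f: "x = (\<Sum>k\<in>I. f k *s \<theta> k)" using bD(2)[OF \<open>x \<in> M\<close>] by blast
    let ?s = "\<Sum>k\<in>I. f k * g k"
    \<comment> \<open>The coordinate at \<open>i\<close> absorbs what the subtraction
      removes.\<close>
    let ?f = "\<lambda>k. f k + (if k = i then ?s else 0)"
    have s: "(\<Sum>k\<in>I. ?f k * g k) = ?s"
      using assms(5) by (intro sum.cong) auto
    have "x = (\<Sum>k\<in>I. ?f k *s (\<theta> k - g k *s \<theta> i))"
      unfolding collect s f by (simp only: add_diff_cancel_right')
    then show ?thesis by (rule exI[where x = ?f])
  qed
  show "f k = 0" if f: "(\<Sum>k\<in>I. f k *s (\<theta> k - g k *s \<theta> i)) = 0" and k: "k \<in> I" for f k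
  proof -
    have *: "f k - (if k = i then (\<Sum>k\<in>I. f k * g k) else 0) = 0" if "k \<in> I" for k
      using bD(3)[OF f[unfolded collect] that] .
    have "(\<Sum>k\<in>I. f k * g k) = 0"
    proof (intro sum.neutral ballI)
      show "f k * g k = 0" if "k \<in> I" for k
        using *[OF that] assms(5) by (cases "k = i") simp_all
    qed
    then show ?thesis
      using *[OF k] by (simp split: if_splits)
  qed
qed

section \<open>Adapted bases\<close>

lemma subspace_log_der: "der.subspace (log_der \<A>)"
  by (auto simp: der.subspace_def log_der_def der_apply_0 der_apply_add der_apply_scale)

lemma euler_der_in_log_der: "euler_der \<in> log_der \<A>"
  by (simp add: log_der_def defining_form_def euler_der_lin_form)

lemma mhomogeneous_der_apply_lin_form:
  "(\<And>i. mhomogeneous d (\<theta> $ i)) \<Longrightarrow> mhomogeneous d (der_apply \<theta> (lin_form a))"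
  unfolding der_apply_lin_form by (intro mhomogeneous_sum mhomogeneous_mconst_mult)

text \<open>The components are the values on the coordinate forms, and every other value on a linear
  form is a combination of them with scalar coefficients.\<close>

lemma der_homogeneous_iff: "der_homogeneous d \<theta> \<longleftrightarrow> (\<forall>i. mhomogeneous d (\<theta> $ i))"
proof
  assume h: "der_homogeneous d \<theta>"
  have "der_apply \<theta> (lin_form (axis i 1)) = \<theta> $ i" for i
  proof -
    have "der_apply \<theta> (lin_form (axis i 1)) = (\<Sum>j\<in>UNIV. if j = i then \<theta> $ i else 0)"
      unfolding der_apply_lin_form by (intro sum.cong) (auto simp: axis_def)
    then show ?thesis by simp
  qed
  then show "\<forall>i. mhomogeneous d (\<theta> $ i)"
    using h unfolding der_homogeneous_def by (metis mhomogeneous_0)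
next
  assume "\<forall>i. mhomogeneous d (\<theta> $ i)"
  then show "der_homogeneous d \<theta>"
    unfolding der_homogeneous_def by (simp add: mhomogeneous_der_apply_lin_form)
qed

lemma homogeneous_basis_iff:
  fixes \<A> :: "('k::field ^ 'n) set set"
  shows "homogeneous_basis \<A> d \<theta> \<longleftrightarrow>
    module_basis {1..CARD('n)} (log_der \<A>) \<theta> \<and> (\<forall>i\<in>{1..CARD('n)}. der_homogeneous (d i) (\<theta> i))"
  unfolding homogeneous_basis_def module_basis_iff[OF finite_atLeastAtMost subspace_log_der] by auto

lemma homogeneous_basis_permute:
  fixes \<A> :: "('k::field ^ 'n) set set"
  assumes "homogeneous_basis \<A> d' \<theta>" "\<pi> permutes {1..CARD('n)}"
    and "\<And>i. i \<in> {1..CARD('n)} \<Longrightarrow> d i = d' (\<pi> i)"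
  shows "homogeneous_basis \<A> d (\<theta> \<circ> \<pi>)"
  using assms permutes_in_image[OF assms(2)]
  by (simp add: homogeneous_basis_iff module_basis_permute del: atLeastAtMost_iff)

text \<open>A multiset records the degrees only up to order, so the basis is permuted until its
  degrees follow \<open>d\<close>.\<close>

lemma free_with_exponents_basis:
  fixes \<A> :: "('k::field ^ 'n) set set"
  assumes "free_with_exponents \<A> (image_mset d (mset_set {1..CARD('n)}))"
  obtains \<theta> where "homogeneous_basis \<A> d \<theta>"
proof -
  obtain d' \<theta> where b: "homogeneous_basis \<A> d' \<theta>"
    and eq: "image_mset d (mset_set {1..CARD('n)}) = image_mset d' (mset_set {1..CARD('n)})"
    using assms by (auto simp: free_with_exponents_def)
  obtain \<pi> where "\<pi> permutes {1..CARD('n)}" "\<forall>i\<in>{1..CARD('n)}. d i = d' (\<pi> i)"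
    using image_mset_eq_implies_permutes[OF _ eq] by auto
  then show thesis
    using homogeneous_basis_permute[OF b] that by blast
qed

text \<open>In the degree-one part of an expansion of the Euler derivation only scalar multiples of
  basis elements of degree 1 survive. As the derivation is nonzero, one scalar is a unit, and the
  Euler derivation can replace that element.\<close>

lemma homogeneous_basis_euler:
  fixes \<A> :: "('k::field ^ 'n) set set"
  assumes "homogeneous_basis \<A> d \<theta>" "d 1 = 1" "\<And>i. i \<in> {1..CARD('n)} \<Longrightarrow> 1 \<le> d i"
  obtains \<eta> where "homogeneous_basis \<A> d \<eta>" "\<eta> 1 = euler_der"
proof -
  let ?I = "{1..CARD('n)}"
  have mb: "module_basis ?I (log_der \<A>) \<theta>" and hom: "\<And>i. i \<in> ?I \<Longrightarrow> der_homogeneous (d i) (\<theta> i)"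
    using assms(1) by (auto simp: homogeneous_basis_iff)
  obtain f where f: "euler_der = (\<Sum>k\<in>?I. f k *s \<theta> k)"
    using module_basisD(2)[OF mb euler_der_in_log_der] by blast
  \<comment> \<open>\<open>c k\<close> is the constant term of \<open>f k\<close> when
    \<open>d k = 1\<close>; elements of larger degree contribute nothing in degree 1.\<close>
  define c where "c = (\<lambda>k. if d k = 1 then lookup (hcomp 0 (f k)) 0 else 0)"
  have euler: "euler_der = (\<Sum>k\<in>?I. mconst (c k) *s \<theta> k)"
  proof -
    have "mvar i = (\<Sum>k\<in>?I. mconst (c k) * \<theta> k $ i)" for i
    proof -
      have "mvar i = (\<Sum>k\<in>?I. f k * \<theta> k $ i)"
        using arg_cong[OF f, of "\<lambda>x. x $ i"] by (simp add: euler_der_def)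
      then have "hcomp 1 (mvar i) = (\<Sum>k\<in>?I. hcomp 1 (f k * \<theta> k $ i))"
        by (simp add: hcomp_simps)
      also have "hcomp 1 (mvar i) = mvar i"
        using hcomp_mhomogeneous[OF mhomogeneous_mvar, of 1 i] by simp
      also have "(\<Sum>k\<in>?I. hcomp 1 (f k * \<theta> k $ i)) = (\<Sum>k\<in>?I. mconst (c k) * \<theta> k $ i)"
      proof (intro sum.cong refl)
        fix k assume k: "k \<in> ?I"
        have "mhomogeneous (d k) (\<theta> k $ i)"
          using hom[OF k] by (simp add: der_homogeneous_iff)
        note hcomp_mult[OF this, of 1 "f k"]
        moreover have "hcomp 0 (f k) = mconst (lookup (hcomp 0 (f k)) 0)"
          by (rule mhomogeneous_0_const[OF mhomogeneous_hcomp])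
        ultimately show "hcomp 1 (f k * \<theta> k $ i) = mconst (c k) * \<theta> k $ i"
          using assms(3)[OF k] by (cases "d k = 1") (auto simp: c_def)
      qed
      finally show ?thesis .
    qed
    then show ?thesis
      by (simp add: vec_eq_iff euler_der_def)
  qed
  have "(euler_der :: ('n, 'k) derivation) \<noteq> 0"
  proof
    assume "(euler_der :: ('n, 'k) derivation) = 0"
    then have "lookup (mvar i :: ('n, 'k) mpoly) (single i 1) = 0" for i
      by (simp add: euler_der_def vec_eq_iff)
    then show False
      by (simp add: mvar_def)
  qed
  moreover have "(euler_der :: ('n, 'k) derivation) = 0" if "\<forall>k\<in>?I. c k = 0"
    using that by (subst euler) (intro sum.neutral, simp)
  ultimately obtain k where k: "k \<in> ?I" "c k \<noteq> 0"
    by blast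
  then have dk: "d k = 1"
    by (auto simp: c_def split: if_splits)
  have "mconst (inverse (c k)) * mconst (c k) = (1 :: ('n, 'k) mpoly)"
    using k(2) by (simp add: mconst_mult[symmetric])
  then have "module_basis ?I (log_der \<A>) (\<theta>(k := euler_der))"
    by (rule module_basis_exchange[OF mb finite_atLeastAtMost k(1) euler_der_in_log_der euler])
  moreover have "der_homogeneous 1 (euler_der :: ('n, 'k) derivation)"
    unfolding der_homogeneous_iff euler_der_def vec_lambda_beta by (intro allI mhomogeneous_mvar)
  ultimately have "homogeneous_basis \<A> d (\<theta>(k := euler_der))"
    using hom dk by (simp add: homogeneous_basis_iff)
  \<comment> \<open>Both places \<open>1\<close> and \<open>k\<close> have exponent 1, so the swap
    preserves the degrees.\<close>
  moreover have "Transposition.transpose 1 k permutes ?I"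
    using k(1) by (intro permutes_swap_id) auto
  ultimately have "homogeneous_basis \<A> d (\<theta>(k := euler_der) \<circ> Transposition.transpose 1 k)"
    by (rule homogeneous_basis_permute) (auto simp: Transposition.transpose_def assms(2)[unfolded One_nat_def] dk[unfolded One_nat_def])
  then show thesis
    by (rule that) (simp add: Transposition.transpose_def)
qed

section \<open>Values at a point outside the arrangement\<close>

lemma poly_eval_der_apply:
  "poly_eval p (der_apply \<theta> (lin_form a)) = lin_eval a (\<chi> i. poly_eval p (\<theta> $ i))"
  by (simp add: der_apply_lin_form lin_eval_def poly_eval_simps)

lemma poly_eval_dvd_0: "f dvd g \<Longrightarrow> poly_eval p f = 0 \<Longrightarrow> poly_eval p g = 0"
  by (auto simp: poly_eval_simps elim!: dvdE)

text \<open>\<open>Q \<partial>\<^sub>i\<close> is logarithmic for the product \<open>Q\<close> of the \<open>\<alpha>\<^sub>H\<close>, and \<open>Q p \<noteq> 0\<close>: outside the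
  arrangement the logarithmic derivations span the tangent space.\<close>

lemma module_basis_spans_at_point:
  fixes \<A> :: "('k::field ^ 'n) set set"
  assumes "arrangement \<A>" "p \<notin> \<Union>\<A>" "module_basis I (log_der \<A>) \<theta>"
    and zero: "\<And>k. k \<in> I \<Longrightarrow> poly_eval p (der_apply (\<theta> k) (lin_form a)) = 0"
  shows "a = 0"
proof -
  have fin: "finite \<A>" and hyp: "\<And>L. L \<in> \<A> \<Longrightarrow> hyperplane L"
    using assms(1) by (auto simp: arrangement_def)
  define Q :: "('n, 'k) mpoly" where "Q = (\<Prod>L\<in>\<A>. lin_form (dv L))"
  have "poly_eval p Q \<noteq> 0"
    unfolding Q_def poly_eval_simps poly_eval_lin_form
    using fin assms(2) mem_hyperplane_iff[OF hyp] by auto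
  moreover have "a $ i * poly_eval p Q = 0" for i
  proof -
    let ?\<eta> = "Q *s axis i 1 :: ('n, 'k) derivation"
    have "lin_form (dv L) dvd der_apply ?\<eta> (lin_form (dv L))" if "L \<in> \<A>" for L
      unfolding der_apply_scale Q_def using fin that by (intro dvd_mult2 dvd_prodI)
    then have "?\<eta> \<in> log_der \<A>"
      by (simp add: log_der_def defining_form_def)
    then obtain f where f: "?\<eta> = (\<Sum>k\<in>I. f k *s \<theta> k)"
      using module_basisD(2)[OF assms(3)] by blast
    \<comment> \<open>By the expansion the value is 0; computed directly it is \<open>a $ i\<close>
      times the value of \<open>Q\<close> at \<open>p\<close>.\<close>
    have "poly_eval p (der_apply ?\<eta> (lin_form a)) = 0"
      unfolding f der_apply_sum der_apply_scale poly_eval_simps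
      by (intro sum.neutral ballI) (simp add: zero)
    moreover have "poly_eval p (der_apply ?\<eta> (lin_form a)) = lin_eval a (poly_eval p Q *s axis i 1)"
      unfolding poly_eval_der_apply
      by (rule arg_cong[where f = "lin_eval a"]) (simp add: vec_eq_iff axis_def poly_eval_simps)
    ultimately show ?thesis
      by (simp add: lin_eval_linear lin_eval_axis mult.commute)
  qed
  ultimately show ?thesis
    by (simp add: vec_eq_iff)
qed

section \<open>Independence of the added forms and diagonalisation at a point\<close>

lemma dim_INT_hyperplanes:
  fixes H :: "'i \<Rightarrow> ('k::field ^ 'n) set"
  assumes "finite J" "\<And>j. j \<in> J \<Longrightarrow> hyperplane (H j)"
  shows "CARD('n) \<le> vec.dim (\<Inter>j\<in>J. H j) + card J"
  using assms
proof (induction J)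
  case empty
  then show ?case by (simp add: card_cart_basis)
next
  case (insert j J)
  let ?U = "\<Inter>j\<in>J. H j"
  have "vec.subspace ?U"
    using insert.prems by (auto simp: vec.subspace_def hyperplane_def)
  moreover have "vec.subspace (H j)" "vec.dim (H j) + 1 = CARD('n)"
    using insert.prems by (auto simp: hyperplane_def)
  \<comment> \<open>By the dimension formula, and since the sum lies in the whole space, one more
    hyperplane lowers the dimension by at most one.\<close>
  ultimately have "vec.dim {x + y |x y. x \<in> H j \<and> y \<in> ?U} + vec.dim (H j \<inter> ?U) + 1 = CARD('n) + vec.dim ?U"
    using vec.dim_sums_Int[of "H j" ?U] by simp
  moreover have "vec.dim {x + y |x y. x \<in> H j \<and> y \<in> ?U} \<le> CARD('n)"
    using vec.dim_subset[OF subset_UNIV, of "{x + y |x y. x \<in> H j \<and> y \<in> ?U}"]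
    by (simp add: card_cart_basis)
  moreover have "CARD('n) \<le> vec.dim ?U + card J"
    using insert by blast
  ultimately show ?case
    using insert.hyps by simp
qed

text \<open>A form depending on the others would vanish on their common zeros. Its hyperplane could
  then be dropped without changing the intersection, leaving too few hyperplanes for the
  codimension.\<close>

lemma defining_vecs_independent:
  fixes H :: "'i \<Rightarrow> ('k::field ^ 'n) set"
  assumes "finite J" "\<And>j. j \<in> J \<Longrightarrow> hyperplane (H j)" "i \<in> J" "K \<subseteq> J - {i}"
    and "vec.dim (\<Inter>j\<in>J. H j) + card J = CARD('n)"
  shows "dv (H i) \<noteq> (\<Sum>j\<in>K. t j *s dv (H j))"
proof
  assume eq: "dv (H i) = (\<Sum>j\<in>K. t j *s dv (H j))"
  have "v \<in> H i" if v: "\<And>j. j \<in> J - {i} \<Longrightarrow> v \<in> H j" for v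
  proof -
    have "lin_eval (dv (H j)) v = 0" if "j \<in> K" for j
      using v[of j] mem_hyperplane_iff[OF assms(2), of j v] that assms(4) by auto
    then have "lin_eval (dv (H i)) v = 0"
      unfolding eq lin_eval_sum by (intro sum.neutral) (simp add: lin_eval_linear)
    then show ?thesis
      using mem_hyperplane_iff[OF assms(2)[OF assms(3)]] by simp
  qed
  then have "(\<Inter>j\<in>J. H j) = (\<Inter>j\<in>J - {i}. H j)"
    using assms(3) by blast
  moreover have "CARD('n) \<le> vec.dim (\<Inter>j\<in>J - {i}. H j) + card (J - {i})"
    using assms(1,2) by (intro dim_INT_hyperplanes) auto
  moreover have "card J = Suc (card (J - {i}))"
    using assms(1,3) by (metis card.remove)
  ultimately show False
    using assms(5) by simp
qed

text \<open>Nonvanishing at \<open>p\<close>, stronger than non-divisibility when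
  \<open>p \<in> H\<close>, supplies the pivots: the values at \<open>p\<close> form a diagonal
  pattern on the forms already treated.\<close>

definition adapted ::
  "('k::field ^ 'n) set \<Rightarrow> 'k ^ 'n \<Rightarrow> (nat \<Rightarrow> ('n, 'k) derivation) \<Rightarrow> nat \<Rightarrow> bool" where
  "adapted H p \<theta> j \<longleftrightarrow>
     (\<forall>k\<in>{1..CARD('n)} - {j}. lin_form (dv H) dvd der_apply (\<theta> k) (lin_form (dv H))) \<and>
     poly_eval p (der_apply (\<theta> j) (lin_form (dv H))) \<noteq> 0"

lemma adapted_poly_eval:
  fixes H :: "('k::field ^ 'n) set"
  assumes "adapted H p \<theta> j" "hyperplane H" "p \<in> H" "k \<in> {1..CARD('n)}"
  shows "poly_eval p (der_apply (\<theta> k) (lin_form (dv H))) = 0 \<longleftrightarrow> k \<noteq> j"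
proof (cases "k = j")
  case False
  have "poly_eval p (lin_form (dv H)) = 0"
    using assms(2,3) by (simp add: poly_eval_lin_form mem_hyperplane_iff)
  moreover have "lin_form (dv H) dvd der_apply (\<theta> k) (lin_form (dv H))"
    using assms(1,4) False by (simp add: adapted_def)
  ultimately show ?thesis
    using False poly_eval_dvd_0 by blast
qed (use assms(1) in \<open>simp add: adapted_def\<close>)

text \<open>This finds the pivot. If all candidates vanished, subtracting suitable multiples of the
  later forms, whose values at \<open>p\<close> are already diagonal, from the form of
  \<open>H n\<close> would give one that vanishes on the whole basis at \<open>p\<close>. By
  \<open>module_basis_spans_at_point\<close> it would be zero, against \<open>indep\<close>.\<close>

lemma exists_nonvanishing_basis_element:
  fixes \<A> :: "('k::field ^ 'n) set set"
  assumes "arrangement \<A>" "p \<notin> \<Union>\<A>" "module_basis {1..CARD('n)} (log_der \<A>) \<theta>"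
    and hyp: "\<And>j. j \<in> {n..CARD('n)} \<Longrightarrow> hyperplane (H j)"
    and p: "\<And>j. j \<in> {n..CARD('n)} \<Longrightarrow> p \<in> H j"
    and indep: "\<And>t. dv (H n) \<noteq> (\<Sum>j\<in>{Suc n..CARD('n)}. t j *s dv (H j))"
    and adapted: "\<And>j. j \<in> {Suc n..CARD('n)} \<Longrightarrow> adapted (H j) p \<theta> j"
  shows "\<exists>j\<in>{1..n} \<inter> {1..CARD('n)}. poly_eval p (der_apply (\<theta> j) (lin_form (dv (H n)))) \<noteq> 0"
proof (rule ccontr)
  assume neg: "\<not> ?thesis"
  let ?val = "\<lambda>j k. poly_eval p (der_apply (\<theta> k) (lin_form (dv (H j))))"
  let ?J = "{Suc n..CARD('n)}"
  \<comment> \<open>\<open>?val j j\<close> is nonzero by \<open>adapted\<close>, so the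
    \<open>j\<close>-th multiple matches the value of the form of \<open>H n\<close> on
    \<open>\<theta> j\<close>.\<close>
  define t where "t = (\<lambda>j. ?val n j / ?val j j)"
  have "dv (H n) - (\<Sum>j\<in>?J. t j *s dv (H j)) = 0"
  proof (rule module_basis_spans_at_point[OF assms(1-3)])
    fix k assume k: "k \<in> {1..CARD('n)}"
    let ?v = "\<chi> i. poly_eval p (\<theta> k $ i)"
    have val: "?val j k = lin_eval (dv (H j)) ?v" for j
      by (rule poly_eval_der_apply)
    have "poly_eval p (der_apply (\<theta> k) (lin_form (dv (H n) - (\<Sum>j\<in>?J. t j *s dv (H j)))))
        = ?val n k - (\<Sum>j\<in>?J. t j * ?val j k)"
      by (simp only: poly_eval_der_apply lin_eval_linear lin_eval_sum)
    also have "(\<Sum>j\<in>?J. t j * ?val j k) = (\<Sum>j\<in>?J. if j = k then ?val n k else 0)"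
    proof (intro sum.cong refl)
      fix j assume j: "j \<in> ?J"
      then have "?val j k = 0 \<longleftrightarrow> k \<noteq> j"
        using k hyp p by (intro adapted_poly_eval[OF adapted[OF j]]) auto
      then show "t j * ?val j k = (if j = k then ?val n k else 0)"
        by (auto simp: t_def)
    qed
    also have "\<dots> = ?val n k"
      using neg k by auto
    finally show "poly_eval p (der_apply (\<theta> k) (lin_form (dv (H n) - (\<Sum>j\<in>?J. t j *s dv (H j))))) = 0"
      by simp
  qed
  with indep[of t] show False by simp
qed

text \<open>Gaussian elimination against one more hyperplane: modulo \<open>\<alpha>\<close> all \<open>\<theta>\<^sub>k(\<alpha>)\<close> are multiples of
  Terao's polynomial, whose degree equals that of a basis element not vanishing on \<open>\<alpha>\<close> at \<open>p\<close>.\<close>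

lemma adapted_step:
  fixes \<A> :: "('k::field ^ 'n) set set"
  assumes "arrangement \<A>" "p \<notin> \<Union>\<A>" "homogeneous_basis \<A> d \<theta>" "\<theta> 1 = euler_der"
    and mono: "mono_on {1..CARD('n)} d"
    and n: "2 \<le> n" "n \<le> CARD('n)"
    and hyp: "\<And>j. j \<in> {n..CARD('n)} \<Longrightarrow> hyperplane (H j)"
    and p: "\<And>j. j \<in> {n..CARD('n)} \<Longrightarrow> p \<in> H j"
    and deg: "card \<A> - card (restriction (\<A> \<union> {H n}) (H n)) = d n"
    and indep: "\<And>t. dv (H n) \<noteq> (\<Sum>j\<in>{Suc n..CARD('n)}. t j *s dv (H j))"
    and adapted: "\<And>j. j \<in> {Suc n..CARD('n)} \<Longrightarrow> adapted (H j) p \<theta> j"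
  obtains \<eta> where "homogeneous_basis \<A> d \<eta>" "\<eta> 1 = euler_der"
    "\<And>j. j \<in> {n..CARD('n)} \<Longrightarrow> adapted (H j) p \<eta> j"
proof -
  let ?I = "{1..CARD('n)}"
  let ?l = "\<lambda>j. lin_form (dv (H j))"
  have nI: "n \<in> ?I" "n \<in> {n..CARD('n)}" using n by auto
  have l_p: "poly_eval p (?l j) = 0" if "j \<in> {n..CARD('n)}" for j
    using that p hyp by (simp add: poly_eval_lin_form mem_hyperplane_iff[symmetric])
  have mb: "module_basis ?I (log_der \<A>) \<theta>"
    and hom: "\<And>k i. k \<in> ?I \<Longrightarrow> mhomogeneous (d k) (\<theta> k $ i)"
    using assms(3) by (auto simp: homogeneous_basis_iff der_homogeneous_iff)
  have "H n \<notin> \<A>" using p[OF nI(2)] assms(2) by blast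
  then obtain B where B: "mhomogeneous (d n) B"
    and B_dvd: "\<And>\<theta>. \<theta> \<in> log_der \<A> \<Longrightarrow> \<exists>c. ?l n dvd der_apply \<theta> (?l n) - c * B"
    using terao_polynomial[OF assms(1) hyp[OF nI(2)]] unfolding deg by metis
  have coeff: "\<exists>c. mhomogeneous (d k - d n) c \<and> (d k < d n \<longrightarrow> c = 0) \<and>
      ?l n dvd der_apply (\<theta> k) (?l n) - c * B" if k: "k \<in> ?I" for k
  proof -
    obtain c where "?l n dvd der_apply (\<theta> k) (?l n) - c * B"
      using B_dvd module_basisD(1)[OF mb k] by blast
    then show ?thesis
      using dvd_diff_mult_homogeneous[OF mhomogeneous_der_apply_lin_form[OF hom[OF k]] B mhomogeneous_lin_form]
      by metis
  qed
  obtain j where j: "j \<in> {1..n}" "j \<in> ?I" and val_j: "poly_eval p (der_apply (\<theta> j) (?l n)) \<noteq> 0"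
    using exists_nonvanishing_basis_element[OF assms(1,2) mb hyp p indep adapted] by blast
  \<comment> \<open>Monotonicity gives one inequality since \<open>j \<le> n\<close>; in smaller
    degree the coefficient of \<open>B\<close> would be 0 and the value at \<open>p\<close> would
    vanish.\<close>
  have dj: "d j = d n"
  proof (rule antisym)
    show "d j \<le> d n"
      using j nI by (intro mono_onD[OF mono]) auto
    show "d n \<le> d j"
    proof (rule ccontr)
      assume "\<not> d n \<le> d j"
      then have "?l n dvd der_apply (\<theta> j) (?l n)"
        using coeff[OF j(2)] by auto
      then show False
        using poly_eval_dvd_0 l_p[OF nI(2)] val_j by blast
    qed
  qed
  \<comment> \<open>The Euler derivation maps the form to itself, which vanishes at
    \<open>p\<close>. Together with \<open>2 \<le> n\<close> this keeps it in first place when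
    \<open>j\<close> and \<open>n\<close> are swapped.\<close>
  have "j \<noteq> 1"
    using val_j l_p[OF nI(2)] by (auto simp: assms(4)[unfolded One_nat_def] euler_der_lin_form)
  define \<pi> where "\<pi> = Transposition.transpose n j"
  have \<pi>: "\<pi> permutes ?I"
    unfolding \<pi>_def using nI j by (intro permutes_swap_id) auto
  define \<theta>' where "\<theta>' = \<theta> \<circ> \<pi>"
  have d\<pi>: "d (\<pi> k) = d k" for k
    by (simp add: \<pi>_def Transposition.transpose_def dj)
  have \<theta>'_n: "\<theta>' n = \<theta> j" and \<theta>'_1: "\<theta>' 1 = euler_der"
    using \<open>j \<noteq> 1\<close> n assms(4) by (auto simp: \<theta>'_def \<pi>_def Transposition.transpose_def)
  have mb': "module_basis ?I (log_der \<A>) \<theta>'"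
    unfolding \<theta>'_def by (rule module_basis_permute[OF mb \<pi>])
  have \<pi>_I: "\<pi> k \<in> ?I" if "k \<in> ?I" for k
    using that permutes_in_image[OF \<pi>] by blast
  have hom': "mhomogeneous (d k) (\<theta>' k $ i)" if "k \<in> ?I" for k i
    using hom[OF \<pi>_I[OF that]] by (simp add: \<theta>'_def d\<pi>)
  \<comment> \<open>The swap only involves indices up to \<open>n\<close>, so it fixes the pivots of
    the later hyperplanes.\<close>
  have adapted': "adapted (H i) p \<theta>' i" if i: "i \<in> {Suc n..CARD('n)}" for i
  proof -
    have "\<pi> i = i"
      using i j by (auto simp: \<pi>_def Transposition.transpose_def)
    moreover have "\<pi> k \<in> ?I - {i}" if "k \<in> ?I - {i}" for k
      using that \<pi>_I[of k] permutes_inj[OF \<pi>] \<open>\<pi> i = i\<close> by (metis Diff_iff injD singletonD singletonI)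
    ultimately show ?thesis
      using adapted[OF i] unfolding adapted_def \<theta>'_def o_apply by metis
  qed
  have "\<forall>k\<in>?I. \<exists>c. mhomogeneous (d k - d n) c \<and> (d k < d n \<longrightarrow> c = 0) \<and>
      ?l n dvd der_apply (\<theta>' k) (?l n) - c * B"
    using coeff[OF \<pi>_I] by (simp add: \<theta>'_def d\<pi>)
  then obtain c where c_hom: "\<And>k. k \<in> ?I \<Longrightarrow> mhomogeneous (d k - d n) (c k)"
    and c_0: "\<And>k. k \<in> ?I \<Longrightarrow> d k < d n \<Longrightarrow> c k = 0"
    and c_dvd: "\<And>k. k \<in> ?I \<Longrightarrow> ?l n dvd der_apply (\<theta>' k) (?l n) - c k * B"
    by metis
  \<comment> \<open>The coefficient \<open>c n\<close> has degree \<open>d n - d n = 0\<close>, so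
    it is a scalar.\<close>
  obtain u where u: "c n = mconst u"
    using mhomogeneous_0_const[of "c n"] c_hom[OF nI(1)] by auto
  have "u \<noteq> 0"
  proof
    assume "u = 0"
    then have "?l n dvd der_apply (\<theta> j) (?l n)"
      using c_dvd[OF nI(1)] by (simp add: u \<theta>'_n)
    then show False
      using poly_eval_dvd_0 l_p[OF nI(2)] val_j by blast
  qed
  \<comment> \<open>These multiples of the pivot cancel the \<open>B\<close> terms. Index 1 is
    exempt: the Euler derivation must stay and is already logarithmic along
    \<open>H n\<close>.\<close>
  define g where "g = (\<lambda>k. if k = n \<or> k = 1 then 0 else c k * mconst (inverse u))"
  define \<eta> where "\<eta> = (\<lambda>k. \<theta>' k - g k *s \<theta>' n)"
  have apply_\<eta>: "der_apply (\<eta> k) f = der_apply (\<theta>' k) f - g k * der_apply (\<theta>' n) f" for k f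
    by (simp add: \<eta>_def der_apply_diff der_apply_scale)
  have \<eta>_n: "\<eta> n = \<theta> j" and \<eta>_1: "\<eta> 1 = euler_der"
    using \<theta>'_n \<theta>'_1 by (simp_all add: \<eta>_def g_def)
  show thesis
  proof (rule that[of \<eta>])
    have "module_basis ?I (log_der \<A>) \<eta>"
      unfolding \<eta>_def
      by (rule module_basis_eliminate[OF mb' finite_atLeastAtMost nI(1) subspace_log_der]) (simp add: g_def)
    moreover have "mhomogeneous (d k) (\<eta> k $ i)" if k: "k \<in> ?I" for k i
    proof -
      have "mhomogeneous (d k) (g k * \<theta>' n $ i)"
      proof (cases "k = n \<or> k = 1 \<or> d k < d n")
        case True
        then have "g k = 0" using c_0[OF k] by (auto simp: g_def)
        then show ?thesis by simp
      next
        case False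
        then have "mhomogeneous (d k - d n + d n) (g k * \<theta>' n $ i)"
          using mhomogeneous_mconst_mult[OF c_hom[OF k], of "inverse u"]
          by (intro mhomogeneous_mult hom'[OF nI(1)]) (simp add: g_def mult.commute[of "c k"])
        with False show ?thesis by simp
      qed
      then show ?thesis
        using hom'[OF k] by (simp add: \<eta>_def mhomogeneous_diff)
    qed
    ultimately show "homogeneous_basis \<A> d \<eta>"
      by (simp add: homogeneous_basis_iff der_homogeneous_iff)
    show "\<eta> 1 = euler_der" by (fact \<eta>_1)
    show "adapted (H i) p \<eta> i" if i: "i \<in> {n..CARD('n)}" for i
    proof (cases "i = n")
      case True
      have "?l n dvd der_apply (\<eta> k) (?l n)" if k: "k \<in> ?I - {n}" for k
      proof (cases "k = 1")
        case True
        then show ?thesis using \<eta>_1 by (simp add: euler_der_lin_form)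
      next
        case False
        have "mconst (inverse u) * mconst u = (1 :: ('n, 'k) mpoly)"
          using \<open>u \<noteq> 0\<close> by (simp add: mconst_mult[symmetric])
        then have "c k * mconst (inverse u) * (mconst u * B) = c k * B"
          by (metis mult.assoc mult_1)
        then have "der_apply (\<eta> k) (?l n) = (der_apply (\<theta>' k) (?l n) - c k * B)
            - c k * mconst (inverse u) * (der_apply (\<theta>' n) (?l n) - c n * B)"
          using False k by (simp add: apply_\<eta> g_def u right_diff_distrib)
        then show ?thesis
          using c_dvd[of k] c_dvd[OF nI(1)] k by (metis DiffD1 dvd_diff dvd_mult)
      qed
      then show ?thesis
        using True val_j by (simp add: adapted_def \<eta>_n)
    next
      case False
      then have i': "i \<in> {Suc n..CARD('n)}" using i by auto
      have dvd: "?l i dvd der_apply (\<theta>' k) (?l i)" if "k \<in> ?I - {i}" for k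
        using adapted'[OF i'] that by (simp add: adapted_def)
      \<comment> \<open>\<open>n\<close> differs from \<open>i\<close>, so the pivot being
        subtracted is already logarithmic along \<open>H i\<close> and leaves the earlier
        eliminations intact.\<close>
      have dvd_n: "?l i dvd der_apply (\<theta>' n) (?l i)"
        using dvd[of n] nI False by blast
      then have "poly_eval p (der_apply (\<theta>' n) (?l i)) = 0"
        using poly_eval_dvd_0 l_p[OF i] by blast
      then have "poly_eval p (der_apply (\<eta> i) (?l i)) \<noteq> 0"
        using adapted'[OF i'] by (simp add: apply_\<eta> adapted_def poly_eval_simps)
      moreover have "?l i dvd der_apply (\<eta> k) (?l i)" if "k \<in> ?I - {i}" for k
        unfolding apply_\<eta> using dvd[OF that] dvd_n by (intro dvd_diff dvd_mult)
      ultimately show ?thesis by (simp add: adapted_def)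
    qed
  qed
qed

text \<open>Working from the last hyperplane down, the pivot for \<open>H n\<close> has index at
  most \<open>n\<close>, where \<open>mono\<close> bounds its degree by \<open>d n\<close>.\<close>

lemma adapted_basis:
  fixes \<A> :: "('k::field ^ 'n) set set"
  assumes arr: "arrangement \<A>" and p_out: "p \<notin> \<Union>\<A>"
    and basis: "homogeneous_basis \<A> d \<theta>" "\<theta> 1 = euler_der"
    and mono: "mono_on {1..CARD('n)} d"
    and q: "2 \<le> q" "q \<le> CARD('n)"
    and hyp: "\<And>j. j \<in> {q..CARD('n)} \<Longrightarrow> hyperplane (H j)"
    and p: "\<And>j. j \<in> {q..CARD('n)} \<Longrightarrow> p \<in> H j"
    and deg: "\<And>j. j \<in> {q..CARD('n)} \<Longrightarrow> card \<A> - card (restriction (\<A> \<union> {H j}) (H j)) = d j"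
    and dim: "vec.dim (\<Inter>j\<in>{q..CARD('n)}. H j) + card {q..CARD('n)} = CARD('n)"
  obtains \<eta> where "homogeneous_basis \<A> d \<eta>" "\<eta> 1 = euler_der"
    "\<And>j. j \<in> {q..CARD('n)} \<Longrightarrow> adapted (H j) p \<eta> j"
proof -
  \<comment> \<open>The downward induction starts at \<open>Suc CARD('n)\<close>, where no
    hyperplane is treated yet.\<close>
  have "q \<le> Suc CARD('n)" using q by simp
  then have "\<exists>\<eta>. homogeneous_basis \<A> d \<eta> \<and> \<eta> 1 = euler_der \<and>
      (\<forall>j\<in>{q..CARD('n)}. adapted (H j) p \<eta> j)"
  proof (induction rule: inc_induct)
    case base
    then show ?case using basis by auto
  next
    case (step n)
    then obtain \<theta> where \<theta>: "homogeneous_basis \<A> d \<theta>" "\<theta> 1 = euler_der"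
      "\<And>j. j \<in> {Suc n..CARD('n)} \<Longrightarrow> adapted (H j) p \<theta> j"
      by blast
    have n: "n \<in> {q..CARD('n)}" "2 \<le> n" "n \<le> CARD('n)"
      using step q by auto
    have sub: "j \<in> {q..CARD('n)}" if "j \<in> {n..CARD('n)}" for j
      using that n by auto
    have "dv (H n) \<noteq> (\<Sum>j\<in>{Suc n..CARD('n)}. t j *s dv (H j))" for t
      using n(1) by (intro defining_vecs_independent[OF _ hyp _ _ dim]) auto
    then obtain \<eta> where "homogeneous_basis \<A> d \<eta>" "\<eta> 1 = euler_der"
      "\<And>j. j \<in> {n..CARD('n)} \<Longrightarrow> adapted (H j) p \<eta> j"
      using adapted_step[OF arr p_out \<theta>(1,2) mono n(2,3) hyp[OF sub] p[OF sub] deg[OF n(1)] _ \<theta>(3)]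
      by blast
    then show ?case by blast
  qed
  then show thesis using that by blast
qed

section \<open>Passage to the enlarged arrangement\<close>

lemma log_der_mono: "\<A> \<subseteq> \<B> \<Longrightarrow> log_der \<B> \<subseteq> log_der \<A>"
  by (auto simp: log_der_def)

text \<open>For \<open>x\<close> logarithmic along \<open>H j\<close>, applying an expansion of
  \<open>x\<close> to the form of \<open>H j\<close> leaves, modulo that form, only the term of
  \<open>\<theta> j\<close>. The value of \<open>\<theta> j\<close> is nonzero at
  \<open>p \<in> H j\<close>, so it is not divisible, and primality moves the form into the
  coefficient \<open>f j\<close>.\<close>

lemma module_basis_add_hyperplanes:
  fixes \<A> :: "('k::field ^ 'n) set set"
  assumes basis: "module_basis {1..CARD('n)} (log_der \<A>) \<theta>"
    and q: "1 \<le> q"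
    and hyp: "\<And>j. j \<in> {q..CARD('n)} \<Longrightarrow> hyperplane (H j)"
    and p: "\<And>j. j \<in> {q..CARD('n)} \<Longrightarrow> p \<in> H j"
    and adapted: "\<And>j. j \<in> {q..CARD('n)} \<Longrightarrow> adapted (H j) p \<theta> j"
  shows "module_basis {1..CARD('n)} (log_der (\<A> \<union> H ` {q..CARD('n)}))
    (\<lambda>k. if k < q then \<theta> k else lin_form (dv (H k)) *s \<theta> k)"
    (is "module_basis ?I ?M ?\<zeta>")
proof (rule module_basisI)
  let ?l = "\<lambda>j. lin_form (dv (H j))"
  note bD = module_basisD[OF basis]
  have nz: "dv (H j) \<noteq> 0" if "j \<in> {q..CARD('n)}" for j
    using that hyp defining_vec_nonzero by blast
  have dvd: "?l j dvd der_apply (\<theta> k) (?l j)" if "j \<in> {q..CARD('n)}" "k \<in> ?I" "k \<noteq> j" for j k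
    using adapted[OF that(1)] that by (simp add: adapted_def)
  show "?\<zeta> k \<in> ?M" if k: "k \<in> ?I" for k
  proof -
    have "?\<zeta> k \<in> log_der \<A>"
      using bD(1)[OF k] by (simp add: der.subspace_scale[OF subspace_log_der])
    moreover have "?l j dvd der_apply (?\<zeta> k) (?l j)" if j: "j \<in> {q..CARD('n)}" for j
      using j k dvd[OF j k] by (cases "k = j") (auto simp: der_apply_scale)
    ultimately show ?thesis
      by (auto simp: log_der_def defining_form_def)
  qed
  show "\<exists>f. x = (\<Sum>k\<in>?I. f k *s ?\<zeta> k)" if x: "x \<in> ?M" for x
  proof -
    have "x \<in> log_der \<A>"
      using x log_der_mono by blast
    then obtain f where f: "x = (\<Sum>k\<in>?I. f k *s \<theta> k)"
      using bD(2) by blast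
    have "?l j dvd f j" if j: "j \<in> {q..CARD('n)}" for j
    proof -
      have jI: "j \<in> ?I" using j q by auto
      have "?l j dvd (\<Sum>k\<in>?I. f k * der_apply (\<theta> k) (?l j))"
        using log_der_dvd[OF x, of "H j"] j by (simp add: f der_apply_sum der_apply_scale)
      also have "\<dots> = f j * der_apply (\<theta> j) (?l j) + (\<Sum>k\<in>?I - {j}. f k * der_apply (\<theta> k) (?l j))"
        using jI by (intro sum.remove) auto
      finally have "?l j dvd f j * der_apply (\<theta> j) (?l j) + (\<Sum>k\<in>?I - {j}. f k * der_apply (\<theta> k) (?l j))" .
      moreover have "?l j dvd (\<Sum>k\<in>?I - {j}. f k * der_apply (\<theta> k) (?l j))"
        using dvd[OF j] by (intro dvd_sum dvd_mult) blast
      ultimately have "?l j dvd f j * der_apply (\<theta> j) (?l j)"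
        by (simp add: dvd_add_left_iff)
      moreover have "\<not> ?l j dvd der_apply (\<theta> j) (?l j)"
      proof
        assume "?l j dvd der_apply (\<theta> j) (?l j)"
        moreover have "poly_eval p (?l j) = 0"
          using p[OF j] hyp[OF j] by (simp add: poly_eval_lin_form mem_hyperplane_iff[symmetric])
        ultimately show False
          using poly_eval_dvd_0 adapted[OF j] unfolding adapted_def by blast
      qed
      ultimately show ?thesis
        using lin_form_dvd_mult[OF nz[OF j]] by blast
    qed
    then have "\<forall>j\<in>{q..CARD('n)}. \<exists>g. f j = g * ?l j"
      unfolding dvd_def by (metis mult.commute)
    then obtain g where g: "\<And>j. j \<in> {q..CARD('n)} \<Longrightarrow> f j = g j * ?l j"
      by metis
    have "x = (\<Sum>k\<in>?I. (if k < q then f k else g k) *s ?\<zeta> k)"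
      unfolding f by (intro sum.cong) (auto simp: g)
    then show ?thesis by (rule exI[where x = "\<lambda>k. if k < q then f k else g k"])
  qed
  show "f k = 0" if f: "(\<Sum>k\<in>?I. f k *s ?\<zeta> k) = 0" and k: "k \<in> ?I" for f k
  proof -
    \<comment> \<open>Absorbing the forms into the coefficients gives a relation in the old basis,
      and the ring has no zero divisors.\<close>
    let ?g = "\<lambda>k. if k < q then f k else f k * ?l k"
    have "(\<Sum>k\<in>?I. ?g k *s \<theta> k) = (\<Sum>k\<in>?I. f k *s ?\<zeta> k)"
      by (intro sum.cong) auto
    with f have "(\<Sum>k\<in>?I. ?g k *s \<theta> k) = 0" by (simp only:)
    from bD(3)[OF this k] show ?thesis
      using nz[of k] k mpoly_no_zero_divisors[of "f k" "?l k"] by (auto split: if_splits)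
  qed
qed

theorem theorem1p4:
  fixes \<A>' \<A> :: "('k::field ^ 'n) set set"
    and H :: "nat \<Rightarrow> ('k ^ 'n) set"
    and X :: "('k ^ 'n) set"
    and d :: "nat \<Rightarrow> nat"
    and q :: nat
  assumes "arrangement \<A>'"
    and "free_with_exponents \<A>' (image_mset d (mset_set {1..CARD('n)}))"
    and "d 1 = 1"
    and "mono_on {1..CARD('n)} d"
    and "2 \<le> q" and "q \<le> CARD('n)"
    and "\<And>j. j \<in> {q..CARD('n)} \<Longrightarrow> hyperplane (H j)"
    and "\<A> = \<A>' \<union> H ` {q..CARD('n)}"
    and "X = (\<Inter>i\<in>{q..CARD('n)}. H i)"
    and "\<And>j. j \<in> {q..CARD('n)} \<Longrightarrow>
           int (card \<A>') - int (card (restriction (\<A>' \<union> {H j}) (H j))) = int (d j)"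
    and "int CARD('n) - int (vec.dim X) = int CARD('n) - int q + 1"
    and "\<not> X \<subseteq> (\<Union>K\<in>\<A>'. K)"
  shows "free_with_exponents \<A>
           (image_mset (\<lambda>i. if i < q then d i else d i + 1) (mset_set {1..CARD('n)})) \<and>
         (\<exists>\<theta>. homogeneous_basis \<A>' d \<theta> \<and> \<theta> 1 = euler_der \<and>
              (\<forall>i\<in>{2..q - 1}. \<theta> i \<in> log_der \<A>) \<and>
              (\<forall>j\<in>{q..CARD('n)}. \<theta> j \<in> log_der (\<A> - {H j})))"
proof -
  let ?I = "{1..CARD('n)}" and ?J = "{q..CARD('n)}"
  let ?d = "\<lambda>i. if i < q then d i else d i + 1"
  obtain p where p: "\<And>j. j \<in> ?J \<Longrightarrow> p \<in> H j" and p_out: "p \<notin> \<Union>\<A>'"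
    using assms(9,12) by blast
  have d_pos: "1 \<le> d i" if "i \<in> ?I" for i
    using mono_onD[OF assms(4), of 1 i] that assms(3) by auto
  obtain \<theta>\<^sub>0 where "homogeneous_basis \<A>' d \<theta>\<^sub>0"
    using free_with_exponents_basis[OF assms(2)] .
  then obtain \<theta>\<^sub>1 where \<theta>\<^sub>1: "homogeneous_basis \<A>' d \<theta>\<^sub>1" "\<theta>\<^sub>1 1 = euler_der"
    using homogeneous_basis_euler assms(3) d_pos by blast
  \<comment> \<open>The integer difference is nonnegative, being \<open>d j\<close>, so the
    truncated one agrees with it.\<close>
  have deg: "card \<A>' - card (restriction (\<A>' \<union> {H j}) (H j)) = d j" if "j \<in> ?J" for j
    using assms(10)[OF that] by linarith
  \<comment> \<open>\<open>card ?J\<close> is \<open>CARD('n) - q + 1\<close>, the codimension of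
    \<open>X\<close>.\<close>
  have "vec.dim X + card ?J = CARD('n)"
    using assms(5,6,11) by simp
  then obtain \<theta> where basis: "homogeneous_basis \<A>' d \<theta>" and euler: "\<theta> 1 = euler_der"
    and adapted: "\<And>j. j \<in> ?J \<Longrightarrow> adapted (H j) p \<theta> j"
    using adapted_basis[OF assms(1) p_out \<theta>\<^sub>1 assms(4-7) p deg] unfolding assms(9) by blast
  have mb: "module_basis ?I (log_der \<A>') \<theta>"
    and hom: "\<And>k i. k \<in> ?I \<Longrightarrow> mhomogeneous (d k) (\<theta> k $ i)"
    using basis by (auto simp: homogeneous_basis_iff der_homogeneous_iff)
  let ?\<zeta> = "\<lambda>k. if k < q then \<theta> k else lin_form (dv (H k)) *s \<theta> k"
  have "module_basis ?I (log_der \<A>) ?\<zeta>"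
    unfolding assms(8) using assms(5,7) p adapted by (intro module_basis_add_hyperplanes[OF mb]) auto
  moreover have "der_homogeneous (?d k) (?\<zeta> k)" if "k \<in> ?I" for k
    using hom[OF that] mhomogeneous_mult[OF mhomogeneous_lin_form hom[OF that]]
    by (simp add: der_homogeneous_iff)
  ultimately have "homogeneous_basis \<A> ?d ?\<zeta>"
    by (simp add: homogeneous_basis_iff)
  then have "free_with_exponents \<A> (image_mset ?d (mset_set ?I))"
    unfolding free_with_exponents_def by blast
  \<comment> \<open>The free set \<open>\<B>\<close> covers both claims: \<open>{}\<close> for
    indices below \<open>q\<close> and \<open>{H k}\<close> for the others.\<close>
  moreover have in_log_der: "\<theta> k \<in> log_der (\<A> - \<B>)"
    if "k \<in> ?I" "k \<in> ?J \<Longrightarrow> H k \<in> \<B>" for k \<B>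
  proof -
    have "lin_form (dv K) dvd der_apply (\<theta> k) (lin_form (dv K))" if K: "K \<in> \<A> - \<B>" for K
    proof (cases "K \<in> \<A>'")
      case True
      then show ?thesis
        using log_der_dvd[OF module_basisD(1)[OF mb \<open>k \<in> ?I\<close>]] by blast
    next
      case False
      \<comment> \<open>\<open>K\<close> is not in \<open>\<B>\<close>, so its index differs from
        \<open>k\<close>, the only index at which divisibility can fail.\<close>
      then obtain j where "j \<in> ?J" "K = H j" "j \<noteq> k"
        using K \<open>k \<in> ?J \<Longrightarrow> H k \<in> \<B>\<close> assms(8) by blast
      then show ?thesis
        using adapted[of j] \<open>k \<in> ?I\<close> by (simp add: adapted_def)
    qed
    then show ?thesis
      by (simp add: log_der_def defining_form_def)
  qed
  have "\<theta> i \<in> log_der \<A>" if "i \<in> {2..q - 1}" for i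
    using in_log_der[of i "{}"] that assms(6) by auto
  moreover have "\<theta> j \<in> log_der (\<A> - {H j})" if "j \<in> ?J" for j
    using in_log_der[of j "{H j}"] that assms(5) by auto
  ultimately show ?thesis
    using basis euler by blast
qed

end
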